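(* Let $Q$ be a quiver of Dynkin type $\mathbb{A}$. View $\mathcal{TS}(Q)\subset\mathbb{R}^{Q_0}\times\mathbb{R}_{>0}^{Q_0}$ by identifying a stability condition $Z(x)=w\cdot x+(r\cdot x)i$ with the pair $(w,r)$. Then the projection $\mathcal{TS}(Q)\to\mathbb{R}_{>0}^{Q_0}$ sending $(w,r)\mapsto r$ is surjective, and each of its fibers, regarded as a subset of $\mathbb{R}^{Q_0}$ (the set of $w$ with $(w,r)\in\mathcal{TS}(Q)$, for fixed $r$), is linearly equivalent to $\mathbb{R}\times\mathbb{R}_{>0}^{Q_1}$, i.e. there is a linear isomorphism $\mathbb{R}^{Q_0}\to\mathbb{R}\times\mathbb{R}^{Q_1}$ carrying the fiber onto $\mathbb{R}\times\mathbb{R}_{>0}^{Q_1}$. In particular, for any $r\in\mathbb{R}_{>0}^{Q_0}$ there is a total stability condition for $Q$ of the form $Z(x)=w\cdot x+(r\cdot x)i$ with $w\in\mathbb{R}^{Q_0}$.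
   Context: Fix an algebraically closed field $\Bbbk$; all representations are finite-dimensional representations over $\Bbbk$. For a quiver $Q$, $Q_0$ is the set of vertices and $Q_1$ the set of arrows. A quiver is of Dynkin type $\mathbb{A}$ (type $\mathbb{A}_n$) if its underlying undirected graph is the path $1-2-\cdots-n$ for some $n\ge 1$; the orientation of the arrows is arbitrary. A (linear) stability condition (also called stability function or central charge) for an acyclic quiver $Q$ is a group homomorphism $Z\colon K_0(Q)\to\mathbb{C}$ such that $Z(M)$ has positive imaginary part for every nonzero representation $M$. Identifying $K_0(Q)\simeq\mathbb{Z}^{Q_0}$ via dimension vectors, it has the form $Z(x)=w\cdot x+(r\cdot x)i$ for a unique pair $(w,r)\in\mathbb{R}^{Q_0}\times(\mathbb{R}_{>0})^{Q_0}$. The slope of a nonzero representation $V$ with dimension vector $d=(\dim V(z))_{z\in Q_0}$ is $\mu_Z(V)=\frac{w\cdot d}{r\cdot d}$. A representation $V$ is $Z$-stable if $\mu_Z(W)<\mu_Z(V)$ for all nonzero proper subrepresentations $W<V$. The set $\mathcal{TS}(Q)$ of total stability conditions is the set of stability conditions $Z$ such that every indecomposable representation of $Q$ is $Z$-stable. *)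

theory Defs
  imports "HOL-Analysis.Analysis" "HOL-Computational_Algebra.Polynomial" "Graph_Theory.Digraph"
begin

section \<open>Quivers of type A\<close>

text \<open>
  A quiver is a \<open>pre_digraph\<close>: \<open>verts Q\<close> is $Q_0$, \<open>arcs Q\<close> is $Q_1$.
  Below, \<open>\<sigma>\<close> numbers the vertices along the path and \<open>\<tau> i\<close> is the only arrow
  joining the \<open>i\<close>-th vertex to the next one, in one direction or the other.
\<close>

definition type_A :: "('v, 'e) pre_digraph \<Rightarrow> bool" where
  "type_A Q \<longleftrightarrow> (\<exists>n \<sigma> \<tau>. 1 \<le> n
      \<and> bij_betw \<sigma> {1..n::nat} (verts Q)
      \<and> bij_betw \<tau> {1..<n} (arcs Q)
      \<and> (\<forall>i\<in>{1..<n}. {tail Q (\<tau> i), head Q (\<tau> i)} = {\<sigma> i, \<sigma> (i + 1)}))"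

lemma type_A_fin_digraph:
  assumes "type_A Q"
  shows "fin_digraph Q"
proof -
  obtain n \<sigma> \<tau> where s: "bij_betw \<sigma> {1..n::nat} (verts Q)"
    and t: "bij_betw \<tau> {1..<n} (arcs Q)"
    and e: "\<forall>i\<in>{1..<n}. {tail Q (\<tau> i), head Q (\<tau> i)} = {\<sigma> i, \<sigma> (i + 1)}"
    using assms unfolding type_A_def by blast
  have ends: "tail Q a \<in> verts Q \<and> head Q a \<in> verts Q" if a: "a \<in> arcs Q" for a
  proof -
    obtain i where i: "i \<in> {1..<n}" "a = \<tau> i"
      using a t unfolding bij_betw_def by blast
    have "\<sigma> i \<in> verts Q" "\<sigma> (i + 1) \<in> verts Q"
      using i(1) bij_betwE[OF s] by auto
    moreover have "{tail Q a, head Q a} = {\<sigma> i, \<sigma> (i + 1)}"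
      using e i by simp
    ultimately show ?thesis by (metis doubleton_eq_iff)
  qed
  show ?thesis
  proof
    show "finite (verts Q)" using s bij_betw_finite by blast
    show "finite (arcs Q)" using t bij_betw_finite by blast
  qed (use ends in auto)
qed


section \<open>Coordinate spaces\<close>

text \<open>
  $R^S$ for a set \<open>S\<close> and $R = \mathbb{Z}, \mathbb{R}$: functions vanishing outside \<open>S\<close>.
\<close>

definition coord_space :: "'i set \<Rightarrow> ('i \<Rightarrow> 'r::zero) set" where
  "coord_space S = {x. \<forall>i. i \<notin> S \<longrightarrow> x i = 0}"

definition pos_orthant :: "'i set \<Rightarrow> ('i \<Rightarrow> real) set" where
  "pos_orthant S = {x \<in> coord_space S. \<forall>i\<in>S. 0 < x i}"

text \<open>Linear isomorphisms $\mathbb{R}^S \to \mathbb{R} \times \mathbb{R}^T$.\<close>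

definition linear_iso ::
    "'i set \<Rightarrow> 'j set \<Rightarrow> (('i \<Rightarrow> real) \<Rightarrow> real \<times> ('j \<Rightarrow> real)) \<Rightarrow> bool" where
  "linear_iso S T L \<longleftrightarrow>
      bij_betw L (coord_space S) (UNIV \<times> coord_space T)
    \<and> (\<forall>x\<in>coord_space S. \<forall>y\<in>coord_space S.
        L (\<lambda>i. x i + y i) = (fst (L x) + fst (L y), \<lambda>j. snd (L x) j + snd (L y) j))
    \<and> (\<forall>c. \<forall>x\<in>coord_space S.
        L (\<lambda>i. c * x i) = (c * fst (L x), \<lambda>j. c * snd (L x) j))"


section \<open>Representations and stability\<close>

text \<open>
  The vector spaces of a representation are finite-dimensional subspaces of an ambient
  infinite-dimensional vector space, which serves as a universe: every finite-dimensional
  representation is isomorphic to one of this form.  Only the restriction of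
  \<open>rmap M a\<close> to the space at the tail of \<open>a\<close> matters.
\<close>

record ('v, 'e, 'b) rep =
  rspace :: "'v \<Rightarrow> 'b set"
  rmap :: "'e \<Rightarrow> 'b \<Rightarrow> 'b"

locale rep_universe = vector_space scale
  for scale :: "'k::field \<Rightarrow> 'b::ab_group_add \<Rightarrow> 'b" (infixr \<open>*s\<close> 75) +
  assumes infinite_dimensional: "\<not> (\<exists>B. finite B \<and> span B = UNIV)"
begin

definition is_rep :: "('v, 'e) pre_digraph \<Rightarrow> ('v, 'e, 'b) rep \<Rightarrow> bool" where
  "is_rep Q M \<longleftrightarrow>
      (\<forall>v\<in>verts Q. subspace (rspace M v) \<and> (\<exists>B. finite B \<and> span B = rspace M v))
    \<and> (\<forall>a\<in>arcs Q.
          rmap M a ` rspace M (tail Q a) \<subseteq> rspace M (head Q a)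
        \<and> (\<forall>x\<in>rspace M (tail Q a). \<forall>y\<in>rspace M (tail Q a).
              rmap M a (x + y) = rmap M a x + rmap M a y)
        \<and> (\<forall>c. \<forall>x\<in>rspace M (tail Q a). rmap M a (c *s x) = c *s rmap M a x))"

definition nonzero :: "('v, 'e) pre_digraph \<Rightarrow> ('v, 'e, 'b) rep \<Rightarrow> bool" where
  "nonzero Q M \<longleftrightarrow> (\<exists>v\<in>verts Q. rspace M v \<noteq> {0})"

definition subrep :: "('v, 'e) pre_digraph \<Rightarrow> ('v, 'e, 'b) rep \<Rightarrow> ('v, 'e, 'b) rep \<Rightarrow> bool" where
  "subrep Q N M \<longleftrightarrow> is_rep Q N
    \<and> (\<forall>v\<in>verts Q. rspace N v \<subseteq> rspace M v)
    \<and> (\<forall>a\<in>arcs Q. \<forall>x\<in>rspace N (tail Q a). rmap N a x = rmap M a x)"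

definition proper_subrep ::
    "('v, 'e) pre_digraph \<Rightarrow> ('v, 'e, 'b) rep \<Rightarrow> ('v, 'e, 'b) rep \<Rightarrow> bool" where
  "proper_subrep Q N M \<longleftrightarrow> subrep Q N M \<and> (\<exists>v\<in>verts Q. rspace N v \<noteq> rspace M v)"

definition direct_sum :: "('v, 'e) pre_digraph \<Rightarrow> ('v, 'e, 'b) rep
    \<Rightarrow> ('v, 'e, 'b) rep \<Rightarrow> ('v, 'e, 'b) rep \<Rightarrow> bool" where
  "direct_sum Q M N1 N2 \<longleftrightarrow> subrep Q N1 M \<and> subrep Q N2 M
    \<and> (\<forall>v\<in>verts Q. rspace N1 v \<inter> rspace N2 v = {0}
        \<and> rspace M v = {x + y | x y. x \<in> rspace N1 v \<and> y \<in> rspace N2 v})"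

definition indecomposable :: "('v, 'e) pre_digraph \<Rightarrow> ('v, 'e, 'b) rep \<Rightarrow> bool" where
  "indecomposable Q M \<longleftrightarrow> is_rep Q M \<and> nonzero Q M
    \<and> \<not> (\<exists>N1 N2. direct_sum Q M N1 N2 \<and> nonzero Q N1 \<and> nonzero Q N2)"

definition dimvec :: "('v, 'e) pre_digraph \<Rightarrow> ('v, 'e, 'b) rep \<Rightarrow> 'v \<Rightarrow> int" where
  "dimvec Q M = (\<lambda>v. if v \<in> verts Q then int (dim (rspace M v)) else 0)"

text \<open>
  $K_0(Q)$ is identified with $\mathbb{Z}^{Q_0}$ via dimension vectors; the values of
  \<open>Z\<close> outside \<open>coord_space (verts Q)\<close> are irrelevant.
\<close>

definition stability_condition ::
    "('v, 'e) pre_digraph \<Rightarrow> (('v \<Rightarrow> int) \<Rightarrow> complex) \<Rightarrow> bool" where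
  "stability_condition Q Z \<longleftrightarrow>
      (\<forall>x\<in>coord_space (verts Q). \<forall>y\<in>coord_space (verts Q). Z (\<lambda>v. x v + y v) = Z x + Z y)
    \<and> (\<forall>M. is_rep Q M \<and> nonzero Q M \<longrightarrow> 0 < Im (Z (dimvec Q M)))"

definition slope ::
    "('v, 'e) pre_digraph \<Rightarrow> (('v \<Rightarrow> int) \<Rightarrow> complex) \<Rightarrow> ('v, 'e, 'b) rep \<Rightarrow> real" where
  "slope Q Z M = Re (Z (dimvec Q M)) / Im (Z (dimvec Q M))"

definition stable ::
    "('v, 'e) pre_digraph \<Rightarrow> (('v \<Rightarrow> int) \<Rightarrow> complex) \<Rightarrow> ('v, 'e, 'b) rep \<Rightarrow> bool" where
  "stable Q Z M \<longleftrightarrow>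
    (\<forall>N. proper_subrep Q N M \<and> nonzero Q N \<longrightarrow> slope Q Z N < slope Q Z M)"

definition total_stability_condition ::
    "('v, 'e) pre_digraph \<Rightarrow> (('v \<Rightarrow> int) \<Rightarrow> complex) \<Rightarrow> bool" where
  "total_stability_condition Q Z \<longleftrightarrow> stability_condition Q Z
    \<and> (\<forall>M. indecomposable Q M \<longrightarrow> stable Q Z M)"

end

text \<open>The central charge $Z(x) = w \cdot x + (r \cdot x)\,i$ on $\mathbb{Z}^{Q_0}$.\<close>

definition central_charge ::
    "('v, 'e) pre_digraph \<Rightarrow> ('v \<Rightarrow> real) \<Rightarrow> ('v \<Rightarrow> real) \<Rightarrow> ('v \<Rightarrow> int) \<Rightarrow> complex" where
  "central_charge Q w r x =
    Complex (\<Sum>v\<in>verts Q. w v * of_int (x v)) (\<Sum>v\<in>verts Q. r v * of_int (x v))"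

text \<open>$\mathcal{TS}(Q)$ as a subset of $\mathbb{R}^{Q_0} \times \mathbb{R}_{>0}^{Q_0}$.\<close>

definition (in rep_universe) TS ::
    "('v, 'e) pre_digraph \<Rightarrow> (('v \<Rightarrow> real) \<times> ('v \<Rightarrow> real)) set" where
  "TS Q = {(w, r). w \<in> coord_space (verts Q) \<and> r \<in> pos_orthant (verts Q)
      \<and> total_stability_condition Q (central_charge Q w r)}"

text \<open>Universes exist over every field, for example the space of polynomials.\<close>

lemma rep_universe_poly: "rep_universe (smult :: 'k::field \<Rightarrow> 'k poly \<Rightarrow> 'k poly)"
proof -
  interpret vector_space "smult :: 'k \<Rightarrow> 'k poly \<Rightarrow> 'k poly"
    by unfold_locales (auto simp: smult_add_left smult_add_right)
  show ?thesis
  proof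
    show "\<not> (\<exists>B :: 'k poly set. finite B \<and> span B = UNIV)"
    proof
      assume "\<exists>B :: 'k poly set. finite B \<and> span B = UNIV"
      then obtain B :: "'k poly set" where B: "finite B" "span B = UNIV" by blast
      define m where "m = Max (insert 0 (degree ` B))"
      have "subspace {p :: 'k poly. degree p \<le> m}"
        unfolding subspace_def by (auto intro: degree_add_le order.trans[OF degree_smult_le])
      moreover have "B \<subseteq> {p. degree p \<le> m}"
        using B(1) by (auto simp: m_def)
      ultimately have "span B \<subseteq> {p. degree p \<le> m}" by (rule span_minimal[rotated])
      then have "degree (monom (1::'k) (Suc m)) \<le> m" using B(2) by blast
      then show False by (simp add: degree_monom_eq)
    qed
  qed
qed

end

theory Submission
  imports Defs
begin

text \<open>
  Number the vertices 1, ..., n along the path and let P_k, for k = 0, ..., n, be the point of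
  the plane with abscissa R_k = r_1 + ... + r_k and ordinate W_k = w_1 + ... + w_k.  The slope
  of a representation with dimension vector the indicator of {a..b} is then the slope of the
  chord from P_(a-1) to P_b.  If the arrow between c and c + 1 points forward, the part on
  {c+1..b} of an interval module on {a..b} is a subrepresentation.  Stability thus forces P_c to
  lie strictly above the chord from P_i to P_j whenever i < c < j; if the arrow points backward,
  P_c must lie strictly below.  So total stability says that P_0, ..., P_n are in convex position, the forward
  arrows marking the upper boundary and the backward arrows the lower one
  (\<open>total_stability_iff_convex_position\<close>).

  That these chord conditions suffice rests on two facts.  Every indecomposable
  is an interval module (\<open>indecomposable_imp_interval_rep\<close>).  And for an arbitrary, possibly
  disconnected, subrepresentation of an interval module, summation by parts writes the relevant
  slope defect as a sum of terms each of which has the right sign by a chord condition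
  (\<open>closed_subset_slope\<close>).

  Convexity of a polygon is a local property of its upper and of its lower boundary.  Hence it
  is enough to bend in the right direction at each P_c with 1 \<le> c < n, relative
  to the two neighbours of P_c on the same boundary (\<open>convex_position_iff_local_bend\<close>).
  This is one linear inequality on w per arrow.  The n - 1 amounts of bending together with
  W_n form a linear coordinate system on the space of all w: an explicit piecewise linear
  function bends by prescribed amounts and has a prescribed end point (\<open>local_bend_surj\<close>), and a
  vector in the kernel would allow moving along a line inside the open set
  of convex positions until one of the points hits the chord from P_0 to P_n
  (\<open>local_bend_kernel\<close>).  In these coordinates the fiber over r is the product of a line and an
  open orthant.
\<close>

section \<open>Points in convex position\<close>

text \<open>
  \<open>fwd c\<close> means that the arrow joining \<open>c\<close> and \<open>c + 1\<close> points from \<open>c\<close> to \<open>c + 1\<close>.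
\<close>

definition arrow_src :: "(nat \<Rightarrow> bool) \<Rightarrow> nat \<Rightarrow> nat" where
  "arrow_src fwd i = (if fwd i then i else i + 1)"

definition arrow_tgt :: "(nat \<Rightarrow> bool) \<Rightarrow> nat \<Rightarrow> nat" where
  "arrow_tgt fwd i = (if fwd i then i + 1 else i)"

lemmas arrow_ends = arrow_src_def arrow_tgt_def

text \<open>
  The subsets of \<open>{a..b}\<close> that occur as supports of subrepresentations of the
  interval module on \<open>{a..b}\<close>.
\<close>

definition successor_closed :: "(nat \<Rightarrow> bool) \<Rightarrow> nat \<Rightarrow> nat \<Rightarrow> nat set \<Rightarrow> bool" where
  "successor_closed fwd a b S \<longleftrightarrow> (\<forall>c\<in>{a..<b}. arrow_src fwd c \<in> S \<longrightarrow> arrow_tgt fwd c \<in> S)"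

text \<open>
  A function \<open>W\<close> on \<open>{..n}\<close> stands for the points \<open>(R k, W k)\<close> of the plane.
\<close>

locale heights =
  fixes n :: nat and R :: "nat \<Rightarrow> real" and fwd :: "nat \<Rightarrow> bool"
  assumes R_less: "i < j \<Longrightarrow> j \<le> n \<Longrightarrow> R i < R j"
    and R_0: "R 0 = 0"
    and n_pos: "1 \<le> n"
begin

definition chord :: "(nat \<Rightarrow> real) \<Rightarrow> nat \<Rightarrow> nat \<Rightarrow> real" where
  "chord W i j = (W j - W i) / (R j - R i)"

lemma chord_uminus: "chord (\<lambda>k. - W k) i j = - chord W i j"
  by (simp add: chord_def diff_divide_distrib)

lemma chord_add: "chord (\<lambda>k. W k + W' k) i j = chord W i j + chord W' i j"
  by (simp add: chord_def add_divide_distrib[symmetric])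

lemma chord_scale: "chord (\<lambda>k. c * W k) i j = c * chord W i j"
  by (simp add: chord_def algebra_simps)

text \<open>
  The slope from \<open>i\<close> to \<open>k\<close> is a weighted mean, with positive weights, of the slopes
  from \<open>i\<close> to \<open>j\<close> and from \<open>j\<close> to \<open>k\<close>, so it lies strictly between them or all three agree.
\<close>

lemma chord_mediant:
  assumes "i < j" "j < k" "k \<le> n"
  shows "chord W i j < chord W j k \<longleftrightarrow> chord W i j < chord W i k"
    and "chord W i j < chord W j k \<longleftrightarrow> chord W i k < chord W j k"
    and "chord W j k < chord W i j \<longleftrightarrow> chord W i k < chord W i j"
    and "chord W j k < chord W i j \<longleftrightarrow> chord W j k < chord W i k"
proof -
  define p q A B where "p = R j - R i" and "q = R k - R j" and "A = W j - W i" and "B = W k - W j"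
  have p: "0 < p" and q: "0 < q"
    using R_less[of i j] R_less[of j k] assms by (auto simp: p_def q_def)
  have eqs: "R k - R i = p + q" "W k - W i = A + B"
    by (auto simp: p_def q_def A_def B_def)
  show "chord W i j < chord W j k \<longleftrightarrow> chord W i j < chord W i k"
    and "chord W i j < chord W j k \<longleftrightarrow> chord W i k < chord W j k"
    and "chord W j k < chord W i j \<longleftrightarrow> chord W i k < chord W i j"
    and "chord W j k < chord W i j \<longleftrightarrow> chord W j k < chord W i k"
    unfolding chord_def eqs p_def[symmetric] q_def[symmetric] A_def[symmetric] B_def[symmetric]
    using p q by (auto simp: divide_simps algebra_simps)
qed

text \<open>
  Concavity of a polygonal chain is local: a triple whose gaps contain a further point of
  the chain is reduced to two narrower triples by inserting that point.
\<close>

lemma chain_concave: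
  assumes "C \<subseteq> {..n}"
    and local: "\<And>i j k. \<lbrakk>i \<in> C; j \<in> C; k \<in> C; i < j; j < k; \<forall>m\<in>C. m \<le> i \<or> m = j \<or> k \<le> m\<rbrakk>
      \<Longrightarrow> chord W j k < chord W i j"
    and "i \<in> C" "j \<in> C" "k \<in> C" "i < j" "j < k"
  shows "chord W j k < chord W i j"
  using assms(3-)
proof (induction "k - i" arbitrary: i j k rule: less_induct)
  case less
  have kn: "k \<le> n" using less.prems(3) assms(1) by auto
  consider m where "m \<in> C" "i < m" "m < j" | m where "m \<in> C" "j < m" "m < k"
    | "\<forall>m\<in>C. m \<le> i \<or> m = j \<or> k \<le> m"
    by (meson linorder_not_le nat_neq_iff)
  then show ?case
  proof cases
    case (1 m)
    have "chord W j k < chord W m j" by (rule less.hyps) (use 1 less.prems in auto)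
    also have "chord W m j < chord W i j"
    proof -
      have "chord W m j < chord W i m" by (rule less.hyps) (use 1 less.prems in auto)
      then show ?thesis using chord_mediant(4)[of i m j W] 1 less.prems kn by auto
    qed
    finally show ?thesis .
  next
    case (2 m)
    have "chord W j m < chord W i j" by (rule less.hyps) (use 2 less.prems in auto)
    moreover have "chord W j k < chord W j m"
    proof -
      have "chord W m k < chord W j m" by (rule less.hyps) (use 2 less.prems in auto)
      then show ?thesis using chord_mediant(3)[of j m k W] 2 less.prems kn by auto
    qed
    ultimately show ?thesis by simp
  next
    case 3
    then show ?thesis using local less.prems by blast
  qed
qed

text \<open>
  An end of the chord that lies on the lower chain may be replaced by the end of
  the whole polygon on the same side, because the lower chain runs below the chord from the first to
  the last point and the upper chain above it.  This only makes the inequality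
  harder and leaves three points of the concave chain.
\<close>

lemma above_chords:
  assumes ends: "0 \<in> C" "n \<in> C" "0 \<in> D" "n \<in> D" and cover: "{..n} \<subseteq> C \<union> D"
    and concave: "\<And>i j k. \<lbrakk>i \<in> C; j \<in> C; k \<in> C; i < j; j < k\<rbrakk> \<Longrightarrow> chord W j k < chord W i j"
    and convex: "\<And>i j k. \<lbrakk>i \<in> D; j \<in> D; k \<in> D; i < j; j < k\<rbrakk> \<Longrightarrow> chord W i j < chord W j k"
    and c: "c \<in> C" "i < c" "c < j" "j \<le> n"
  shows "chord W c j < chord W i c"
proof -
  have mid: "chord W c n < chord W 0 c"
    by (rule concave) (use ends c in auto)
  define i' where "i' = (if i \<in> C then i else 0)"
  define j' where "j' = (if j \<in> C then j else n)"
  have "chord W i' c \<le> chord W i c"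
  proof (cases "i \<in> C")
    case False
    have i: "i \<in> D" using cover c False by (meson UnE atMost_iff less_imp_le_nat less_le_trans subsetD)
    have i0: "0 < i" using ends False by (metis gr0I)
    have "chord W 0 i < chord W i n" by (rule convex) (use i i0 ends c in auto)
    then have "chord W 0 i < chord W 0 n" using chord_mediant(1)[of 0 i n W] i0 c by auto
    also have "\<dots> < chord W 0 c" using chord_mediant(3)[of 0 c n W] mid c by auto
    finally have "chord W 0 i < chord W 0 c" .
    then have "chord W 0 i < chord W i c" using chord_mediant(1)[of 0 i c W] i0 c by simp
    then have "chord W 0 c < chord W i c" using chord_mediant(2)[of 0 i c W] i0 c by simp
    then show ?thesis using False by (simp add: i'_def)
  qed (simp add: i'_def)
  moreover have "chord W c j \<le> chord W c j'"
  proof (cases "j \<in> C")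
    case False
    have j: "j \<in> D" "j < n" using cover ends c False by (blast, metis le_neq_implies_less)
    have "chord W 0 j < chord W j n" by (rule convex) (use j ends c in auto)
    then have "chord W 0 n < chord W j n" using chord_mediant(2)[of 0 j n W] j c by auto
    moreover have "chord W c n < chord W 0 n" using chord_mediant(4)[of 0 c n W] mid c by auto
    ultimately have "chord W c n < chord W j n" by simp
    then have "chord W c j < chord W j n" using chord_mediant(2)[of c j n W] j c by simp
    then have "chord W c j < chord W c n" using chord_mediant(1)[of c j n W] j c by simp
    then show ?thesis using False by (simp add: j'_def)
  qed (simp add: j'_def)
  moreover have "chord W c j' < chord W i' c"
    by (rule concave) (use ends c in \<open>auto simp: i'_def j'_def\<close>)
  ultimately show ?thesis by simp
qed

text \<open>
  A positive bend means that the point \<open>c\<close> lies strictly on the side of the chord from \<open>i\<close> to \<open>j\<close>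
  that the arrow after \<open>c\<close> prescribes: above for a forward arrow, below for a backward one.
\<close>

definition arrow_sign :: "bool \<Rightarrow> real" where
  "arrow_sign b = (if b then 1 else -1)"

definition bend :: "(nat \<Rightarrow> real) \<Rightarrow> nat \<Rightarrow> nat \<Rightarrow> nat \<Rightarrow> real" where
  "bend W i c j = arrow_sign (fwd c) * (chord W i c - chord W c j)"

text \<open>
  The vertices of the upper (\<open>True\<close>) or lower (\<open>False\<close>) boundary of the polygon, both of which
  contain its two ends.
\<close>

definition chain :: "bool \<Rightarrow> nat set" where
  "chain b = {0, n} \<union> {i \<in> {1..<n}. fwd i = b}"

definition left_neighbour :: "nat \<Rightarrow> nat" where
  "left_neighbour c = Max {i \<in> chain (fwd c). i < c}"

definition right_neighbour :: "nat \<Rightarrow> nat" where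
  "right_neighbour c = Min {i \<in> chain (fwd c). c < i}"

lemma finite_chain [simp]: "finite (chain b)"
  by (simp add: chain_def)

lemma chain_subset: "chain b \<subseteq> {..n}"
  by (auto simp: chain_def)

lemma neighbours:
  assumes "c \<in> {1..<n}"
  shows "left_neighbour c \<in> chain (fwd c)" "left_neighbour c < c" "right_neighbour c \<in> chain (fwd c)" "c < right_neighbour c" "right_neighbour c \<le> n"
    and "\<And>m. m \<in> chain (fwd c) \<Longrightarrow> m \<le> left_neighbour c \<or> m = c \<or> right_neighbour c \<le> m"
proof -
  have "left_neighbour c \<in> {i \<in> chain (fwd c). i < c}" unfolding left_neighbour_def
    by (rule Max_in) (use assms in \<open>auto simp: chain_def\<close>)
  moreover have "right_neighbour c \<in> {i \<in> chain (fwd c). c < i}" unfolding right_neighbour_def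
    by (rule Min_in) (use assms in \<open>auto simp: chain_def\<close>)
  ultimately show "left_neighbour c \<in> chain (fwd c)" "left_neighbour c < c" "right_neighbour c \<in> chain (fwd c)" "c < right_neighbour c" "right_neighbour c \<le> n"
    using chain_subset by auto
  show "m \<le> left_neighbour c \<or> m = c \<or> right_neighbour c \<le> m" if "m \<in> chain (fwd c)" for m
    using that by (cases m c rule: linorder_cases) (auto simp: left_neighbour_def right_neighbour_def)
qed

lemma neighbours_unique:
  assumes "c \<in> {1..<n}" and "i \<in> chain (fwd c)" "k \<in> chain (fwd c)" "i < c" "c < k"
    and "\<forall>m\<in>chain (fwd c). m \<le> i \<or> m = c \<or> k \<le> m"
  shows "i = left_neighbour c" "k = right_neighbour c"
  using neighbours[OF assms(1)] assms(2-)
  by (metis leD order.strict_trans1 order_antisym order_less_imp_not_eq nat_less_le)+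

definition convex_position :: "(nat \<Rightarrow> real) \<Rightarrow> bool" where
  "convex_position W \<longleftrightarrow> (\<forall>i c j. i < c \<and> c < j \<and> j \<le> n \<longrightarrow> 0 < bend W i c j)"

definition local_bend :: "(nat \<Rightarrow> real) \<Rightarrow> nat \<Rightarrow> real" where
  "local_bend W c = bend W (left_neighbour c) c (right_neighbour c)"

text \<open>
  The reflection \<open>W \<mapsto> - W\<close> exchanges the two boundaries, so that facts about the concave upper one
  apply to the convex lower one.
\<close>

lemma convex_position_iff_local_bend:
  "convex_position W \<longleftrightarrow> (\<forall>c\<in>{1..<n}. 0 < local_bend W c)"
proof
  assume "convex_position W"
  then show "\<forall>c\<in>{1..<n}. 0 < local_bend W c"
    using neighbours(2,4,5) by (auto simp: convex_position_def local_bend_def)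
next
  assume pos: "\<forall>c\<in>{1..<n}. 0 < local_bend W c"
  have up: "chord W j k < chord W i j"
    if "i \<in> chain True" "j \<in> chain True" "k \<in> chain True" "i < j" "j < k" for i j k
  proof (rule chain_concave[OF chain_subset _ that])
    fix i j k
    assume *: "i \<in> chain True" "j \<in> chain True" "k \<in> chain True" "i < j" "j < k"
      "\<forall>m\<in>chain True. m \<le> i \<or> m = j \<or> k \<le> m"
    then have j: "j \<in> {1..<n}" "fwd j" using chain_subset[of True] by (auto simp: chain_def)
    then have "i = left_neighbour j" "k = right_neighbour j" using neighbours_unique[of j i k] * by auto
    then show "chord W j k < chord W i j"
      using bspec[OF pos j(1)] j(2) by (simp add: local_bend_def bend_def arrow_sign_def)
  qed
  have down: "chord W i j < chord W j k"
    if "i \<in> chain False" "j \<in> chain False" "k \<in> chain False" "i < j" "j < k" for i j k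
  proof -
    have "chord (\<lambda>k. - W k) j k < chord (\<lambda>k. - W k) i j"
    proof (rule chain_concave[OF chain_subset _ that])
      fix i j k
      assume *: "i \<in> chain False" "j \<in> chain False" "k \<in> chain False" "i < j" "j < k"
        "\<forall>m\<in>chain False. m \<le> i \<or> m = j \<or> k \<le> m"
      then have j: "j \<in> {1..<n}" "\<not> fwd j" using chain_subset[of False] by (auto simp: chain_def)
      then have "i = left_neighbour j" "k = right_neighbour j" using neighbours_unique[of j i k] * by auto
      then show "chord (\<lambda>k. - W k) j k < chord (\<lambda>k. - W k) i j"
        using bspec[OF pos j(1)] j(2) by (simp add: local_bend_def bend_def arrow_sign_def chord_uminus)
    qed
    then show ?thesis by (simp add: chord_uminus)
  qed
  have ends: "0 \<in> chain b" "n \<in> chain b" for b by (auto simp: chain_def)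
  have cover: "{..n} \<subseteq> chain b \<union> chain (\<not> b)" for b
  proof
    fix k assume "k \<in> {..n}"
    then consider "k = 0" | "k = n" | "k \<in> {1..<n}" by fastforce
    then show "k \<in> chain b \<union> chain (\<not> b)" by cases (auto simp: chain_def)
  qed
  show "convex_position W"
    unfolding convex_position_def
  proof (intro allI impI, elim conjE)
    fix i c j assume c: "i < c" "c < j" "j \<le> n"
    show "0 < bend W i c j"
    proof (cases "fwd c")
      case True
      have "c \<in> chain True" using True c by (simp add: chain_def)
      then have "chord W c j < chord W i c"
        using above_chords[OF ends ends cover[of True, simplified] up down _ c] by simp
      then show ?thesis using True by (simp add: bend_def arrow_sign_def)
    next
      case False
      have up': "chord (\<lambda>k. - W k) j k < chord (\<lambda>k. - W k) i j"
        if "i \<in> chain False" "j \<in> chain False" "k \<in> chain False" "i < j" "j < k" for i j k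
        using down[OF that] by (simp add: chord_uminus)
      have down': "chord (\<lambda>k. - W k) i j < chord (\<lambda>k. - W k) j k"
        if "i \<in> chain True" "j \<in> chain True" "k \<in> chain True" "i < j" "j < k" for i j k
        using up[OF that] by (simp add: chord_uminus)
      have "c \<in> chain False" using False c by (simp add: chain_def)
      then have "chord (\<lambda>k. - W k) c j < chord (\<lambda>k. - W k) i c"
        using above_chords[OF ends ends cover[of False, simplified] up' down' _ c] by simp
      then show ?thesis using False by (simp add: bend_def arrow_sign_def chord_uminus)
    qed
  qed
qed

lemma local_bend_add: "local_bend (\<lambda>k. W k + W' k) c = local_bend W c + local_bend W' c"
  by (simp add: local_bend_def bend_def chord_add algebra_simps)

lemma local_bend_scale: "local_bend (\<lambda>k. a * W k) c = a * local_bend W c"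
  by (simp add: local_bend_def bend_def chord_scale algebra_simps)

text \<open>
  On the boundary of type \<open>b\<close> take a linear function and add, for each vertex \<open>c\<close> of that
  boundary, a kink \<open>max 0 (R k - R c)\<close> scaled by the wanted bend; its sign makes the function
  concave on the upper and convex on the lower boundary if the bends are positive.  The two linear
  functions are chosen so that both boundaries end at height \<open>t\<close>.
\<close>

lemma local_bend_surj:
  "\<exists>W. W 0 = 0 \<and> W n = t \<and> (\<forall>c\<in>{1..<n}. local_bend W c = d c)"
proof -
  define I where "I b = {c \<in> {1..<n}. fwd c = b}" for b
  have finI [simp]: "finite (I b)" for b by (simp add: I_def)
  define T where "T b k = (\<Sum>c\<in>I b. d c * max 0 (R k - R c))" for b k
  define s where "s b = (t + arrow_sign b * T b n) / R n" for b
  define F where "F b k = s b * R k - arrow_sign b * T b k" for b k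
  define W where "W k = (if k = n then t else F (fwd k) k)" for k
  have Rn: "0 < R n" using R_less[of 0 n] n_pos R_0 by auto
  have R_le: "R i \<le> R j" if "i \<le> j" "j \<le> n" for i j
    using R_less[of i j] that by (cases "i = j") auto
  have T0: "T b 0 = 0" for b
    unfolding T_def using R_le[of 0] R_0 by (intro sum.neutral) (auto simp: I_def max_def antisym)
  have Fn: "F b n = t" for b using Rn by (simp add: F_def s_def)
  have F0: "F b 0 = 0" for b by (simp add: F_def T0 R_0)
  have W_chain: "W k = F b k" if "k \<in> chain b" for k b
    using that Fn F0 by (auto simp: W_def chain_def)
  \<comment> \<open>Between neighbouring kinks the slope has changed by the bends of the kinks already passed.\<close>
  have slope: "chord (F b) i j = s b - arrow_sign b * (\<Sum>c\<in>{c\<in>I b. c \<le> i}. d c)"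
    if "i < j" "j \<le> n" and gap: "\<And>m. m \<in> I b \<Longrightarrow> m \<le> i \<or> j \<le> m" for b i j
  proof -
    have "T b j - T b i = (\<Sum>c\<in>I b. d c * max 0 (R j - R c) - d c * max 0 (R i - R c))"
      by (simp add: T_def sum_subtractf)
    also have "\<dots> = (\<Sum>c\<in>I b. if c \<le> i then d c * (R j - R i) else 0)"
    proof (rule sum.cong[OF refl])
      fix c assume c: "c \<in> I b"
      show "d c * max 0 (R j - R c) - d c * max 0 (R i - R c)
        = (if c \<le> i then d c * (R j - R i) else 0)"
      proof (cases "c \<le> i")
        case True
        then have "R c \<le> R i" "R c \<le> R j" using R_le[of c i] R_le[of c j] that by auto
        then show ?thesis using True by (simp add: max_def algebra_simps)
      next
        case False
        then have "j \<le> c" "c \<le> n" using gap[OF c] c by (auto simp: I_def)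
        then have "R i \<le> R c" "R j \<le> R c" using R_le[of i c] R_le[of j c] that by auto
        then show ?thesis using False by (simp add: max_def)
      qed
    qed
    also have "\<dots> = (\<Sum>c\<in>{c\<in>I b. c \<le> i}. d c) * (R j - R i)"
      by (simp add: sum.inter_filter[symmetric] sum_distrib_right)
    finally have "T b j - T b i = (\<Sum>c\<in>{c\<in>I b. c \<le> i}. d c) * (R j - R i)" .
    then have "F b j - F b i = (s b - arrow_sign b * (\<Sum>c\<in>{c\<in>I b. c \<le> i}. d c)) * (R j - R i)"
      unfolding F_def by algebra
    then show ?thesis using R_less[of i j] that by (simp add: chord_def)
  qed
  have "local_bend W c = d c" if c: "c \<in> {1..<n}" for c
  proof -
    define b where "b = fwd c"
    note nb = neighbours[OF c, folded b_def]
    have cb: "c \<in> chain b" "c \<in> I b" using c by (auto simp: chain_def I_def b_def)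
    have Isub: "I b \<subseteq> chain b" by (auto simp: I_def chain_def)
    have "chord W (left_neighbour c) c = chord (F b) (left_neighbour c) c"
      using W_chain nb cb by (simp add: chord_def)
    also have "\<dots> = s b - arrow_sign b * (\<Sum>c'\<in>{c'\<in>I b. c' \<le> left_neighbour c}. d c')"
    proof (rule slope)
      show "m \<le> left_neighbour c \<or> c \<le> m" if "m \<in> I b" for m
        using nb(4) nb(6)[of m] that Isub by auto
    qed (use nb c in auto)
    finally have l: "chord W (left_neighbour c) c = s b - arrow_sign b * (\<Sum>c'\<in>{c'\<in>I b. c' \<le> left_neighbour c}. d c')" .
    have "chord W c (right_neighbour c) = chord (F b) c (right_neighbour c)"
      using W_chain nb cb by (simp add: chord_def)
    also have "\<dots> = s b - arrow_sign b * (\<Sum>c'\<in>{c'\<in>I b. c' \<le> c}. d c')"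
    proof (rule slope)
      show "m \<le> c \<or> right_neighbour c \<le> m" if "m \<in> I b" for m
        using nb(2) nb(6)[of m] that Isub by fastforce
    qed (use nb c in auto)
    also have "{c'\<in>I b. c' \<le> c} = insert c {c'\<in>I b. c' \<le> left_neighbour c}"
    proof -
      have "m \<le> left_neighbour c \<or> m = c" if "m \<in> I b" "m \<le> c" for m
        using nb(4) nb(6)[of m] that Isub by auto
      then show ?thesis using nb(2) cb by auto
    qed
    finally have r: "chord W c (right_neighbour c)
      = s b - arrow_sign b * (d c + (\<Sum>c'\<in>{c'\<in>I b. c' \<le> left_neighbour c}. d c'))"
      using nb(2) by (subst (asm) sum.insert) auto
    show ?thesis
      unfolding local_bend_def bend_def l r b_def[symmetric] by (auto simp: arrow_sign_def algebra_simps)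
  qed
  moreover have "W 0 = 0" using W_chain[of 0 True] F0 by (simp add: chain_def)
  moreover have "W n = t" by (simp add: W_def)
  ultimately show ?thesis by blast
qed

text \<open>
  If \<open>W k \<noteq> 0\<close>, some multiple of \<open>W\<close> moves the point \<open>k\<close> of a configuration in convex position,
  with both ends at height zero, onto the chord between the ends.  All local bends stay positive
  along the way, so convexity is preserved, which is absurd.
\<close>

lemma local_bend_kernel:
  assumes "W 0 = 0" "W n = 0" and zero: "\<And>c. c \<in> {1..<n} \<Longrightarrow> local_bend W c = 0" and "k \<le> n"
  shows "W k = 0"
proof (rule ccontr)
  assume k: "W k \<noteq> 0"
  then have k': "0 < k" "k < n" using assms by (metis gr0I, metis le_neq_implies_less)
  obtain W0 where W0: "W0 0 = 0" "W0 n = 0" "\<forall>c\<in>{1..<n}. local_bend W0 c = 1"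
    using local_bend_surj[of 0 "\<lambda>_. 1"] by auto
  define a where "a = - W0 k / W k"
  define U where "U i = W0 i + a * W i" for i
  have "local_bend U c = 1" if "c \<in> {1..<n}" for c
    unfolding U_def local_bend_add local_bend_scale using W0 zero[OF that] that by simp
  then have "convex_position U" by (simp add: convex_position_iff_local_bend)
  then have "0 < bend U 0 k n" using k' by (simp add: convex_position_def)
  moreover have "U 0 = 0" "U n = 0" "U k = 0"
    using W0 assms k by (auto simp: U_def a_def)
  ultimately show False by (simp add: bend_def chord_def)
qed

lemma abel_sum:
  fixes G s :: "nat \<Rightarrow> real"
  assumes "a \<le> b" "1 \<le> a"
  shows "(\<Sum>i=a..b. s i * (G i - G (i - 1)))
    = s b * G b - s a * G (a - 1) + (\<Sum>c=a..<b. G c * (s c - s (c + 1)))"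
  using assms
proof (induction b rule: dec_induct)
  case (step m)
  then show ?case by (simp add: algebra_simps)
qed (simp add: algebra_simps)

text \<open>
  Let \<open>G\<close> measure the height of a point above the chord from \<open>a - 1\<close> to \<open>b\<close>.  Its increments over
  \<open>S\<close> sum up, after summation by parts, to terms supported at the places where the indicator of
  \<open>S\<close> jumps.  Being closed under successors, \<open>S\<close> jumps up only where the arrow is forward, so
  where \<open>G\<close> is positive, and down only where \<open>G\<close> is negative.  Each jump thus contributes a
  negative amount, and a proper nonempty subset has at least one jump.
\<close>

lemma closed_subset_slope:
  assumes cp: "convex_position W" and ab: "1 \<le> a" "a \<le> b" "b \<le> n"
    and S: "S \<subset> {a..b}" "S \<noteq> {}" "successor_closed fwd a b S"
  shows "(\<Sum>i\<in>S. W i - W (i - 1)) / (\<Sum>i\<in>S. R i - R (i - 1)) < chord W (a - 1) b"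
proof -
  define \<mu> where "\<mu> = chord W (a - 1) b"
  define G where "G k = (W k - W (a - 1)) - \<mu> * (R k - R (a - 1))" for k
  define s where "s i = (if i \<in> S then 1 else 0 :: real)" for i
  have Rab: "R (a - 1) < R b" using R_less[of "a - 1" b] ab by auto
  have Gb: "G b = 0" and Ga: "G (a - 1) = 0"
    using Rab by (auto simp: G_def \<mu>_def chord_def)
  have Gc: "0 < arrow_sign (fwd c) * G c" if c: "c \<in> {a..<b}" for c
  proof -
    have lt: "a - 1 < c" "c < b" using c ab by auto
    have Rc: "0 < R c - R (a - 1)" using R_less[of "a - 1" c] lt ab by auto
    have bend: "0 < bend W (a - 1) c b" using cp lt ab unfolding convex_position_def by blast
    have G: "G c = (chord W (a - 1) c - \<mu>) * (R c - R (a - 1))"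
      using Rc by (simp add: G_def chord_def field_simps)
    show ?thesis
    proof (cases "fwd c")
      case True
      then have "\<mu> < chord W (a - 1) c"
        using bend chord_mediant(3)[OF lt ab(3), of W] by (simp add: bend_def arrow_sign_def \<mu>_def)
      then show ?thesis using True Rc G by (simp add: arrow_sign_def)
    next
      case False
      then have "chord W (a - 1) c < \<mu>"
        using bend chord_mediant(1)[OF lt ab(3), of W] by (simp add: bend_def arrow_sign_def \<mu>_def)
      then have "G c < 0" using Rc unfolding G by (intro mult_neg_pos) auto
      then show ?thesis using False by (simp add: arrow_sign_def)
    qed
  qed
  have term_le: "G c * (s c - s (c + 1)) \<le> 0" if c: "c \<in> {a..<b}" for c
    using Gc[OF c] bspec[OF S(3)[unfolded successor_closed_def] c]
    by (cases "fwd c") (auto simp: s_def arrow_sign_def arrow_ends)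
  have ex: "\<exists>c\<in>{a..<b}. s c \<noteq> s (c + 1)"
  proof (rule ccontr)
    assume "\<not> ?thesis"
    then have eq: "s c = s (c + 1)" if "c \<in> {a..<b}" for c using that by blast
    have "s i = s a" if "i \<in> {a..b}" for i
    proof -
      have "a \<le> i" "i \<le> b" using that by auto
      then show ?thesis
      proof (induction i rule: dec_induct)
        case (step m) then show ?case using eq[of m] by auto
      qed simp
    qed
    then have "i \<in> S \<longleftrightarrow> a \<in> S" if "i \<in> {a..b}" for i
      using that by (metis s_def zero_neq_one)
    then show False using S(1,2) by blast
  qed
  then obtain c where c: "c \<in> {a..<b}" "s c \<noteq> s (c + 1)" by blast
  have "G c \<noteq> 0" using Gc[OF c(1)] by auto
  then have "G c * (s c - s (c + 1)) < 0" using term_le[OF c(1)] c(2)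
    by (metis eq_iff_diff_eq_0 less_eq_real_def mult_eq_0_iff)
  then have "(\<Sum>c=a..<b. G c * (s c - s (c + 1))) < (\<Sum>c=a..<b. 0)"
    using term_le c(1) by (intro sum_strict_mono_ex1) auto
  then have "(\<Sum>i=a..b. s i * (G i - G (i - 1))) < 0"
    using abel_sum[OF ab(2,1), of s G] Gb Ga by simp
  also have "(\<Sum>i=a..b. s i * (G i - G (i - 1))) = (\<Sum>i\<in>S. G i - G (i - 1))"
  proof -
    have "(\<Sum>i=a..b. s i * (G i - G (i - 1))) = (\<Sum>i=a..b. if i \<in> S then G i - G (i - 1) else 0)"
      by (rule sum.cong) (auto simp: s_def)
    also have "\<dots> = (\<Sum>i\<in>{i\<in>{a..b}. i \<in> S}. G i - G (i - 1))"
      by (rule sum.inter_filter[symmetric]) simp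
    also have "{i\<in>{a..b}. i \<in> S} = S" using S by auto
    finally show ?thesis .
  qed
  also have "\<dots> = (\<Sum>i\<in>S. W i - W (i - 1)) - \<mu> * (\<Sum>i\<in>S. R i - R (i - 1))"
    by (simp add: G_def sum_distrib_left sum_subtractf[symmetric] algebra_simps)
  finally have "(\<Sum>i\<in>S. W i - W (i - 1)) < \<mu> * (\<Sum>i\<in>S. R i - R (i - 1))" by simp
  moreover have "0 < (\<Sum>i\<in>S. R i - R (i - 1))"
  proof (rule sum_pos)
    show "finite S" using S(1) finite_subset by blast
    show "0 < R i - R (i - 1)" if "i \<in> S" for i
      using R_less[of "i - 1" i] S(1) ab that by fastforce
  qed (use S in auto)
  ultimately show ?thesis by (simp add: \<mu>_def pos_divide_less_eq)
qed

end

section \<open>Splitting off an interval module\<close>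

context rep_universe
begin

text \<open>
  \<open>H\<close> is a hyperplane of \<open>V\<close> complementary to the line through \<open>x\<close>.
\<close>

definition complements :: "'b set \<Rightarrow> 'b \<Rightarrow> 'b set \<Rightarrow> bool" where
  "complements V x H \<longleftrightarrow> subspace H \<and> H \<subseteq> V \<and> x \<in> V \<and> x \<notin> H \<and> (\<forall>v\<in>V. \<exists>k. v - scale k x \<in> H)"

lemma complement_exists:
  assumes U: "subspace U" "U \<subseteq> V" and V: "subspace V" and x: "x \<in> V" "x \<notin> U"
  shows "\<exists>H. complements V x H \<and> U \<subseteq> H"
proof -
  obtain B where B: "B \<subseteq> U" "independent B" "U \<subseteq> span B"
    by (metis basis_exists)
  have spB: "span B = U" using span_subspace[OF B(1,3) U(1)] .
  have ind: "independent (insert x B)"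
    using independent_insertI[of x B] B(2) x(2) spB by simp
  have "insert x B \<subseteq> V" using B U x by auto
  then obtain C where C: "insert x B \<subseteq> C" "C \<subseteq> V" "independent C" "V \<subseteq> span C"
    using maximal_independent_subset_extend[OF _ ind] by metis
  define H where "H = span (C - {x})"
  have "H \<subseteq> V" unfolding H_def using C V by (intro span_minimal) auto
  moreover have "x \<notin> H" using C unfolding H_def dependent_def by auto
  moreover have "\<exists>k. v - scale k x \<in> H" if "v \<in> V" for v
  proof -
    have "insert x (C - {x}) = C" using C by auto
    then have "v \<in> span (insert x (C - {x}))" using C that by auto
    then show ?thesis unfolding H_def using span_breakdown_eq by blast
  qed
  ultimately have "complements V x H"
    unfolding complements_def H_def using x by auto
  moreover have "U \<subseteq> H"
  proof -
    have "B \<subseteq> C - {x}" using B C x by auto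
    then show ?thesis unfolding H_def spB[symmetric] by (rule span_mono)
  qed
  ultimately show ?thesis by blast
qed

lemma complements_nonzero: "complements V x H \<Longrightarrow> x \<noteq> 0"
  using subspace_0 by (auto simp: complements_def)

lemma complements_span:
  assumes "complements V x H" "subspace V"
  shows "span {x} \<inter> H = {0}" and "V = {u + h | u h. u \<in> span {x} \<and> h \<in> H}"
proof -
  note c = assms(1)[unfolded complements_def]
  have "u = 0" if u: "u \<in> span {x}" "u \<in> H" for u
  proof (rule ccontr)
    assume "u \<noteq> 0"
    obtain k where k: "u = scale k x"
      using u(1) by (auto simp: span_singleton)
    with \<open>u \<noteq> 0\<close> have "k \<noteq> 0" by auto
    then have "x = scale (inverse k) u" using k by simp
    then have "x \<in> H" using c u(2) subspace_scale by metis
    then show False using c by blast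
  qed
  moreover have "0 \<in> H" using c subspace_0 by blast
  ultimately show "span {x} \<inter> H = {0}" using span_zero by blast
  show "V = {u + h | u h. u \<in> span {x} \<and> h \<in> H}" (is "_ = ?S")
  proof
    show "V \<subseteq> ?S"
    proof
      fix v assume "v \<in> V"
      then obtain k where k: "v - scale k x \<in> H" using c by blast
      moreover have "scale k x \<in> span {x}" by (simp add: span_scale span_base)
      moreover have "v = scale k x + (v - scale k x)" by simp
      ultimately show "v \<in> ?S" by blast
    qed
    show "?S \<subseteq> V"
    proof
      fix v assume "v \<in> ?S"
      then obtain u h where v: "v = u + h" "u \<in> span {x}" "h \<in> H" by blast
      have "span {x} \<subseteq> V" using c assms(2) by (intro span_minimal) auto
      then show "v \<in> V" using v c assms(2) subspace_add by blast
    qed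
  qed
qed

end

text \<open>
  A representation of a path, with the spaces indexed by vertex numbers and \<open>f i\<close> the map of the
  arrow between \<open>i\<close> and \<open>i + 1\<close>.
\<close>

locale zigzag = rep_universe scale
  for scale :: "'k::field \<Rightarrow> 'b::ab_group_add \<Rightarrow> 'b" (infixr \<open>*s\<close> 75) +
  fixes n :: nat and fwd :: "nat \<Rightarrow> bool" and V :: "nat \<Rightarrow> 'b set" and f :: "nat \<Rightarrow> 'b \<Rightarrow> 'b"
  assumes subspace_V: "i \<in> {1..n} \<Longrightarrow> subspace (V i)"
    and f_in: "i \<in> {1..<n} \<Longrightarrow> x \<in> V (arrow_src fwd i) \<Longrightarrow> f i x \<in> V (arrow_tgt fwd i)"
    and f_add: "i \<in> {1..<n} \<Longrightarrow> x \<in> V (arrow_src fwd i) \<Longrightarrow> y \<in> V (arrow_src fwd i)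
      \<Longrightarrow> f i (x + y) = f i x + f i y"
    and f_scale: "i \<in> {1..<n} \<Longrightarrow> x \<in> V (arrow_src fwd i) \<Longrightarrow> f i (k *s x) = k *s f i x"
begin

lemma ends_in: "i \<in> {1..<n} \<Longrightarrow> arrow_src fwd i \<in> {1..n}" "i \<in> {1..<n} \<Longrightarrow> arrow_tgt fwd i \<in> {1..n}"
  by (auto simp: arrow_ends)

lemma V_scale: "i \<in> {1..n} \<Longrightarrow> x \<in> V i \<Longrightarrow> k *s x \<in> V i"
  using subspace_V subspace_scale by blast

lemma V_diff: "i \<in> {1..n} \<Longrightarrow> x \<in> V i \<Longrightarrow> y \<in> V i \<Longrightarrow> x - y \<in> V i"
  using subspace_V subspace_diff by blast

lemma f_0: "i \<in> {1..<n} \<Longrightarrow> f i 0 = 0"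
  using f_scale[of i 0 0] subspace_0[OF subspace_V[OF ends_in(1)]] by simp

lemma f_diff_scale:
  assumes "i \<in> {1..<n}" "x \<in> V (arrow_src fwd i)" "y \<in> V (arrow_src fwd i)"
  shows "f i (x - k *s y) = f i x - k *s f i y"
proof -
  have "f i (x + (- k) *s y) = f i x + (- k) *s f i y"
    using f_add[OF assms(1,2), of "(- k) *s y"] f_scale[OF assms(1,3), of "- k"]
      V_scale[OF ends_in(1)[OF assms(1)] assms(3), of "- k"] by simp
  then show ?thesis by simp
qed

lemma subspace_image:
  assumes i: "i \<in> {1..<n}" and U: "subspace U" "U \<subseteq> V (arrow_src fwd i)"
  shows "subspace (f i ` U)"
proof (rule subspaceI)
  show "0 \<in> f i ` U" using f_0[OF i] subspace_0[OF U(1)] by force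
  show "x + y \<in> f i ` U" if xy: "x \<in> f i ` U" "y \<in> f i ` U" for x y
  proof -
    obtain u v where uv: "u \<in> U" "v \<in> U" "x = f i u" "y = f i v" using xy by auto
    then have "x + y = f i (u + v)" using f_add[OF i, of u v] U uv by (metis subsetD)
    then show ?thesis using uv subspace_add[OF U(1)] by blast
  qed
  show "c *s x \<in> f i ` U" if x: "x \<in> f i ` U" for c x
  proof -
    obtain u where u: "u \<in> U" "x = f i u" using x by auto
    then have "c *s x = f i (c *s u)" using f_scale[OF i, of u c] U u by (metis subsetD)
    then show ?thesis using u subspace_scale[OF U(1)] by blast
  qed
qed

lemma subspace_preimage:
  assumes i: "i \<in> {1..<n}" and U: "subspace U"
  shows "subspace {x \<in> V (arrow_src fwd i). f i x \<in> U}"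
  using subspace_V[OF ends_in(1)[OF i]] U f_0[OF i] f_add[OF i] f_scale[OF i]
  by (auto intro!: subspaceI simp: subspace_0 subspace_add subspace_scale)

text \<open>
  The decomposition of the line through \<open>x\<close> plus \<open>H\<close> at the vertex \<open>c\<close> extends to a decomposition of the
  restriction to \<open>{c..n}\<close>: the vectors \<open>y i\<close> span an interval module on \<open>{c..b}\<close>, and the
  spaces \<open>K i\<close> form a complementary subrepresentation.  For a backward arrow leaving \<open>b + 1\<close>
  the last condition on the interval module disappears, since the map starts at the zero space there.
\<close>

definition interval_summand :: "nat \<Rightarrow> 'b \<Rightarrow> 'b set \<Rightarrow> bool" where
  "interval_summand c x H \<longleftrightarrow> (\<exists>b y K. c \<le> b \<and> b \<le> n \<and> y c = x \<and> K c = H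
    \<and> (\<forall>i\<in>{c..b}. complements (V i) (y i) (K i))
    \<and> (\<forall>i\<in>{b<..n}. y i = 0 \<and> K i = V i)
    \<and> (\<forall>i\<in>{c..<n}. f i ` K (arrow_src fwd i) \<subseteq> K (arrow_tgt fwd i))
    \<and> (\<forall>i\<in>{c..<b}. f i (y (arrow_src fwd i)) = y (arrow_tgt fwd i))
    \<and> (b < n \<longrightarrow> fwd b \<longrightarrow> f b (y b) = 0))"

lemma interval_summand_stop:
  assumes c: "1 \<le> c" "c \<le> n" and compl: "complements (V c) x H"
    and fw: "c < n \<Longrightarrow> fwd c \<Longrightarrow> f c x = 0"
    and bw: "c < n \<Longrightarrow> \<not> fwd c \<Longrightarrow> f c ` V (c + 1) \<subseteq> H"
  shows "interval_summand c x H"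
proof -
  let ?y = "\<lambda>i. if i = c then x else 0" and ?K = "\<lambda>i. if i = c then H else V i"
  have HV: "H \<subseteq> V c" using compl by (simp add: complements_def)
  have maps: "\<forall>i\<in>{c..<n}. f i ` ?K (arrow_src fwd i) \<subseteq> ?K (arrow_tgt fwd i)"
  proof
    fix i assume i: "i \<in> {c..<n}"
    then have i': "i \<in> {1..<n}" using c by auto
    have "?K (arrow_src fwd i) \<subseteq> V (arrow_src fwd i)" using HV by auto
    then have "f i ` ?K (arrow_src fwd i) \<subseteq> V (arrow_tgt fwd i)" using f_in[OF i'] by auto
    moreover have "f i ` ?K (arrow_src fwd i) \<subseteq> H" if "arrow_tgt fwd i = c"
    proof -
      have "i = c \<and> \<not> fwd c" using that i by (auto simp: arrow_tgt_def split: if_splits)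
      then show ?thesis using bw i by (auto simp: arrow_src_def)
    qed
    ultimately show "f i ` ?K (arrow_src fwd i) \<subseteq> ?K (arrow_tgt fwd i)"
      by (cases "arrow_tgt fwd i = c") (simp_all only: simp_thms if_True if_False)
  qed
  show ?thesis
    unfolding interval_summand_def
    by (intro exI[of _ c] exI[of _ ?y] exI[of _ ?K] conjI maps) (use assms in auto)
qed

lemma interval_summand_step:
  assumes c: "1 \<le> c" "c < n" and compl: "complements (V c) x H"
    and tail: "interval_summand (c + 1) x' H'"
    and fw: "fwd c \<Longrightarrow> f c x = x' \<and> f c ` H \<subseteq> H'"
    and bw: "\<not> fwd c \<Longrightarrow> f c x' = x \<and> f c ` H' \<subseteq> H"
  shows "interval_summand c x H"
proof -
  obtain b y K where *: "c + 1 \<le> b" "b \<le> n" "y (c + 1) = x'" "K (c + 1) = H'"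
    "\<forall>i\<in>{c + 1..b}. complements (V i) (y i) (K i)"
    "\<forall>i\<in>{b<..n}. y i = 0 \<and> K i = V i"
    "\<forall>i\<in>{c + 1..<n}. f i ` K (arrow_src fwd i) \<subseteq> K (arrow_tgt fwd i)"
    "\<forall>i\<in>{c + 1..<b}. f i (y (arrow_src fwd i)) = y (arrow_tgt fwd i)"
    "b < n \<longrightarrow> fwd b \<longrightarrow> f b (y b) = 0"
    using tail unfolding interval_summand_def by auto
  let ?y = "y(c := x)" and ?K = "K(c := H)"
  have later: "arrow_src fwd i \<noteq> c" "arrow_tgt fwd i \<noteq> c" if "c < i" for i
    using that by (auto simp: arrow_ends)
  show ?thesis
    unfolding interval_summand_def
  proof (intro exI conjI)
    show "\<forall>i\<in>{c..b}. complements (V i) (?y i) (?K i)" using *(5) compl by auto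
    show "\<forall>i\<in>{c..<n}. f i ` ?K (arrow_src fwd i) \<subseteq> ?K (arrow_tgt fwd i)"
    proof
      fix i assume i: "i \<in> {c..<n}"
      show "f i ` ?K (arrow_src fwd i) \<subseteq> ?K (arrow_tgt fwd i)"
      proof (cases "i = c")
        case True
        then show ?thesis using fw bw *(4) by (cases "fwd c") (auto simp: arrow_ends)
      next
        case False
        then show ?thesis using i *(7) later[of i] by auto
      qed
    qed
    show "\<forall>i\<in>{c..<b}. f i (?y (arrow_src fwd i)) = ?y (arrow_tgt fwd i)"
    proof
      fix i assume i: "i \<in> {c..<b}"
      show "f i (?y (arrow_src fwd i)) = ?y (arrow_tgt fwd i)"
      proof (cases "i = c")
        case True
        then show ?thesis using fw bw *(3) by (cases "fwd c") (auto simp: arrow_ends)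
      next
        case False
        then show ?thesis using i *(8) later[of i] by auto
      qed
    qed
  qed (use * in auto)
qed

text \<open>
  \<open>A\<close> and \<open>B\<close> are consecutive layers of a filtration of \<open>V c\<close>.  A vector in \<open>B\<close> but not in \<open>A\<close>
  spans the start of an interval that splits off, and the complement at \<open>c\<close> may be any hyperplane that
  contains the lower layer.  This freedom lets the induction below choose the hyperplane.
\<close>

definition splitting :: "nat \<Rightarrow> 'b set \<Rightarrow> 'b set \<Rightarrow> bool" where
  "splitting c A B \<longleftrightarrow>
    (\<forall>x H. x \<in> B \<longrightarrow> x \<notin> A \<longrightarrow> complements (V c) x H \<longrightarrow> A \<subseteq> H \<longrightarrow> interval_summand c x H)"

text \<open>
  The vector \<open>f c x\<close> cannot lie in \<open>f c ` H + A\<close>: otherwise \<open>x\<close> would differ from an element of \<open>H\<close> by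
  a vector in the preimage of \<open>A\<close>, which is contained in \<open>H\<close>.  Hence there is a complement to \<open>f c x\<close> that
  contains both \<open>f c ` H\<close>, as needed for a subrepresentation, and \<open>A\<close>, as needed to continue to
  the right.
\<close>

lemma splitting_preimage:
  assumes c: "1 \<le> c" "c < n" "fwd c" and AB: "splitting (c + 1) A B"
    and A: "subspace A" "A \<subseteq> V (c + 1)"
  shows "splitting c {x \<in> V c. f c x \<in> A} {x \<in> V c. f c x \<in> B}"
  unfolding splitting_def
proof (intro allI impI)
  fix x H
  assume x: "x \<in> {x \<in> V c. f c x \<in> B}" "x \<notin> {x \<in> V c. f c x \<in> A}"
    and compl: "complements (V c) x H" and AH: "{x \<in> V c. f c x \<in> A} \<subseteq> H"
  have c': "c \<in> {1..<n}" and cV: "c \<in> {1..n}" and cV': "c + 1 \<in> {1..n}" using c by auto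
  have sc: "arrow_src fwd c = c" "arrow_tgt fwd c = c + 1" using c by (auto simp: arrow_ends)
  note cp = compl[unfolded complements_def]
  define U where "U = {u + v | u v. u \<in> f c ` H \<and> v \<in> A}"
  have sH: "subspace (f c ` H)" using subspace_image[OF c'] cp sc by auto
  have fH: "f c ` H \<subseteq> V (c + 1)" using f_in[OF c'] cp sc by auto
  have U: "subspace U" unfolding U_def using subspace_sums[OF sH A(1)] .
  have UV: "U \<subseteq> V (c + 1)"
    unfolding U_def using fH A subspace_add[OF subspace_V[OF cV']] by blast
  have fHU: "f c ` H \<subseteq> U" unfolding U_def using subspace_0[OF A(1)] by force
  have AU: "A \<subseteq> U" unfolding U_def using subspace_0[OF sH] by force
  have xU: "f c x \<notin> U"
  proof
    assume "f c x \<in> U"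
    then obtain h v where hv: "h \<in> H" "v \<in> A" "f c x = f c h + v" unfolding U_def by blast
    have hV: "h \<in> V c" using hv cp by auto
    have "f c (x - h) = v"
      using f_diff_scale[OF c', of x h 1] hv hV x sc by simp
    then have "x - h \<in> H" using AH V_diff[OF cV] x hV hv by blast
    then have "x \<in> H" using hv cp subspace_add[of H "x - h" h] by simp
    then show False using cp by blast
  qed
  have fx: "f c x \<in> V (c + 1)" using f_in[OF c'] x sc by auto
  obtain H' where H': "complements (V (c + 1)) (f c x) H'" "U \<subseteq> H'"
    using complement_exists[OF U UV subspace_V[OF cV'] fx xU] by blast
  have "interval_summand (c + 1) (f c x) H'"
    using AB x H' AU unfolding splitting_def by blast
  then show "interval_summand c x H"
    by (rule interval_summand_step[OF c(1,2) compl]) (use c fHU H' in auto)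
qed

text \<open>
  Here the complement on the right is forced to be the preimage of \<open>H\<close>.
\<close>

lemma splitting_image:
  assumes c: "1 \<le> c" "c < n" "\<not> fwd c" and AB: "splitting (c + 1) A B"
    and A: "A \<subseteq> V (c + 1)" and B: "B \<subseteq> V (c + 1)"
  shows "splitting c (f c ` A) (f c ` B)"
  unfolding splitting_def
proof (intro allI impI)
  fix x H
  assume x: "x \<in> f c ` B" "x \<notin> f c ` A"
    and compl: "complements (V c) x H" and AH: "f c ` A \<subseteq> H"
  have c': "c \<in> {1..<n}" and cV': "c + 1 \<in> {1..n}" using c by auto
  have sc: "arrow_src fwd c = c + 1" "arrow_tgt fwd c = c" using c by (auto simp: arrow_ends)
  note cp = compl[unfolded complements_def]
  obtain y where y: "y \<in> B" "x = f c y" "y \<notin> A" using x by blast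
  have yV: "y \<in> V (c + 1)" using y B by auto
  define H' where "H' = {v \<in> V (c + 1). f c v \<in> H}"
  have "subspace H'" using subspace_preimage[OF c', of H] cp sc by (simp add: H'_def)
  moreover have "\<exists>k. v - k *s y \<in> H'" if v: "v \<in> V (c + 1)" for v
  proof -
    have "f c v \<in> V c" using f_in[OF c'] v sc by auto
    then obtain k where "f c v - k *s x \<in> H" using cp by blast
    then have "f c (v - k *s y) \<in> H" using f_diff_scale[OF c'] v yV sc y by simp
    moreover have "v - k *s y \<in> V (c + 1)" using V_diff V_scale cV' v yV by blast
    ultimately show ?thesis by (auto simp: H'_def)
  qed
  ultimately have "complements (V (c + 1)) y H'"
    using yV cp y by (auto simp: complements_def H'_def)
  moreover have "A \<subseteq> H'" using A AH by (auto simp: H'_def)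
  ultimately have "interval_summand (c + 1) y H'" using AB y by (auto simp: splitting_def)
  then show "interval_summand c x H"
    by (rule interval_summand_step[OF c(1,2) compl]) (use c y in \<open>auto simp: H'_def\<close>)
qed

text \<open>
  Induction from the right end.  A forward arrow pulls the filtration back and adds the kernel as a new
  lowest layer, whose vectors start and end an interval at \<open>c\<close>; a backward arrow pushes it forward
  and adds the whole space above the image as a new highest layer, again for intervals
  that end at \<open>c\<close>.
\<close>

lemma splitting_filtration:
  assumes "c \<le> n" "1 \<le> c"
  shows "\<exists>m F. F 0 = {0} \<and> F m = V c \<and> (\<forall>j\<le>m. subspace (F j) \<and> F j \<subseteq> V c)
    \<and> (\<forall>j<m. splitting c (F j) (F (Suc j)))"
  using assms
proof (induction c rule: inc_induct)
  case base
  let ?F = "\<lambda>j::nat. if j = 0 then {0} else V n"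
  have "splitting n {0} (V n)"
    unfolding splitting_def using interval_summand_stop[of n] base by blast
  then have "?F 0 = {0} \<and> ?F 1 = V n \<and> (\<forall>j\<le>1. subspace (?F j) \<and> ?F j \<subseteq> V n)
    \<and> (\<forall>j<1. splitting n (?F j) (?F (Suc j)))"
    using subspace_V[of n] subspace_0[of "V n"] base by auto
  then show ?case by (intro exI)
next
  case (step c)
  obtain m F where F: "F 0 = {0}" "F m = V (c + 1)"
    "\<forall>j\<le>m. subspace (F j) \<and> F j \<subseteq> V (c + 1)"
    "\<forall>j<m. splitting (c + 1) (F j) (F (Suc j))"
    using step by auto
  have c: "1 \<le> c" "c < n" and c': "c \<in> {1..<n}" "c \<in> {1..n}" using step by auto
  have sV: "subspace (V c)" using subspace_V[OF c'(2)] .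
  show ?case
  proof (cases "fwd c")
    case True
    then have sc: "arrow_src fwd c = c" "arrow_tgt fwd c = c + 1" by (auto simp: arrow_ends)
    let ?P = "\<lambda>U. {x \<in> V c. f c x \<in> U}"
    let ?F = "\<lambda>j. case j of 0 \<Rightarrow> {0} | Suc j \<Rightarrow> ?P (F j)"
    have "splitting c {0} (?P {0})"
      unfolding splitting_def using interval_summand_stop[of c] c True by auto
    moreover have "splitting c (?P (F j)) (?P (F (Suc j)))" if "j < m" for j
      using splitting_preimage[OF c True] F that by auto
    ultimately have "\<forall>j<Suc m. splitting c (?F j) (?F (Suc j))"
      using F(1) by (auto split: nat.split simp: less_Suc_eq_0_disj)
    moreover have "\<forall>j\<le>Suc m. subspace (?F j) \<and> ?F j \<subseteq> V c"
      using subspace_preimage[OF c'(1)] F(3) sc subspace_0[OF sV] by (auto split: nat.split)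
    moreover have "?F 0 = {0}" by simp
    moreover have "?F (Suc m) = V c" using f_in[OF c'(1)] F(2) sc by auto
    ultimately show ?thesis by (intro exI[of _ "Suc m"] exI[of _ ?F] conjI)
  next
    case False
    then have sc: "arrow_src fwd c = c + 1" "arrow_tgt fwd c = c" by (auto simp: arrow_ends)
    let ?F = "\<lambda>j. if j \<le> m then f c ` F j else V c"
    have "splitting c (f c ` V (c + 1)) (V c)"
      unfolding splitting_def
      by (intro allI impI, rule interval_summand_stop) (use c False in auto)
    moreover have "splitting c (f c ` F j) (f c ` F (Suc j))" if "j < m" for j
      using splitting_image[OF c False] F that by auto
    ultimately have "\<forall>j<Suc m. splitting c (?F j) (?F (Suc j))"
      using F(2) by (auto simp: less_Suc_eq)
    moreover have "\<forall>j\<le>Suc m. subspace (?F j) \<and> ?F j \<subseteq> V c"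
    proof (intro allI impI)
      fix j assume "j \<le> Suc m"
      have "subspace (f c ` F j) \<and> f c ` F j \<subseteq> V c" if "j \<le> m"
        using subspace_image[OF c'(1), of "F j"] f_in[OF c'(1)] F(3) that sc by auto
      then show "subspace (?F j) \<and> ?F j \<subseteq> V c" using sV by auto
    qed
    moreover have "?F (Suc m) = V c" by simp
    moreover have "?F 0 = {0}" using F(1) f_0[OF c'(1)] by simp
    ultimately show ?thesis by (intro exI[of _ "Suc m"] exI[of _ ?F] conjI)
  qed
qed

lemma interval_summand_exists:
  assumes c: "1 \<le> c" "c \<le> n" and nz: "V c \<noteq> {0}"
  shows "\<exists>x H. interval_summand c x H"
proof -
  obtain m F where F: "F 0 = {0}" "F m = V c" "\<forall>j\<le>m. subspace (F j) \<and> F j \<subseteq> V c"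
    "\<forall>j<m. splitting c (F j) (F (Suc j))"
    using splitting_filtration[OF c(2,1)] by (elim exE conjE) (rule that)
  have "\<exists>j<m. \<not> F (Suc j) \<subseteq> F j"
  proof (rule ccontr)
    assume "\<not> ?thesis"
    then have le: "F (Suc j) \<subseteq> F j" if "j < m" for j using that by blast
    have "F j \<subseteq> F 0" if "j \<le> m" for j
      using that
    proof (induction j)
      case (Suc j) then show ?case using le[of j] by auto
    qed simp
    then have "V c \<subseteq> {0}" using F by auto
    then show False using nz subspace_0[OF subspace_V[of c]] c by auto
  qed
  then obtain j x where j: "j < m" "x \<in> F (Suc j)" "x \<notin> F j" by blast
  have "x \<in> V c" using F(3) j by (meson Suc_leI subsetD)
  then obtain H where "complements (V c) x H" "F j \<subseteq> H"
    using complement_exists[of "F j" "V c" x] F(3) j subspace_V[of c] c by auto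
  then show ?thesis using F(4) j unfolding splitting_def by blast
qed

end

section \<open>Indecomposable representations are interval modules\<close>

locale type_A_reps = rep_universe scale
  for scale :: "'k::field \<Rightarrow> 'b::ab_group_add \<Rightarrow> 'b" (infixr \<open>*s\<close> 75) +
  fixes Q :: "('v, 'e) pre_digraph" and n :: nat and \<sigma> :: "nat \<Rightarrow> 'v" and \<tau> :: "nat \<Rightarrow> 'e"
  assumes n_pos: "1 \<le> n"
    and bij_\<sigma>: "bij_betw \<sigma> {1..n} (verts Q)"
    and bij_\<tau>: "bij_betw \<tau> {1..<n} (arcs Q)"
    and arrows: "i \<in> {1..<n} \<Longrightarrow> {tail Q (\<tau> i), head Q (\<tau> i)} = {\<sigma> i, \<sigma> (i + 1)}"
begin

definition fwd :: "nat \<Rightarrow> bool" where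
  "fwd i \<longleftrightarrow> tail Q (\<tau> i) = \<sigma> i"

abbreviation src :: "nat \<Rightarrow> nat" where "src \<equiv> arrow_src fwd"
abbreviation tgt :: "nat \<Rightarrow> nat" where "tgt \<equiv> arrow_tgt fwd"

lemma verts_eq: "verts Q = \<sigma> ` {1..n}"
  using bij_\<sigma> by (simp add: bij_betw_def)

lemma arcs_eq: "arcs Q = \<tau> ` {1..<n}"
  using bij_\<tau> by (simp add: bij_betw_def)

lemma inj_\<sigma>: "inj_on \<sigma> {1..n}"
  using bij_\<sigma> by (simp add: bij_betw_def)

lemma \<sigma>_in [simp]: "i \<in> {1..n} \<Longrightarrow> \<sigma> i \<in> verts Q"
  by (simp add: verts_eq)

lemma \<tau>_in [simp]: "i \<in> {1..<n} \<Longrightarrow> \<tau> i \<in> arcs Q"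
  by (simp add: arcs_eq)

lemma tail_head:
  assumes "i \<in> {1..<n}"
  shows "tail Q (\<tau> i) = \<sigma> (src i)" "head Q (\<tau> i) = \<sigma> (tgt i)"
proof -
  have "\<sigma> i \<noteq> \<sigma> (i + 1)" using inj_onD[OF inj_\<sigma>, of i "i + 1"] assms by auto
  then show "tail Q (\<tau> i) = \<sigma> (src i)" "head Q (\<tau> i) = \<sigma> (tgt i)"
    using arrows[OF assms] by (auto simp: arrow_ends fwd_def doubleton_eq_iff)
qed

lemma src_tgt_in: "i \<in> {1..<n} \<Longrightarrow> src i \<in> {1..n}" "i \<in> {1..<n} \<Longrightarrow> tgt i \<in> {1..n}"
  by (auto simp: arrow_ends)

definition idx :: "'v \<Rightarrow> nat" where
  "idx = inv_into {1..n} \<sigma>"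

lemma idx_\<sigma> [simp]: "i \<in> {1..n} \<Longrightarrow> idx (\<sigma> i) = i"
  unfolding idx_def by (rule inv_into_f_f[OF inj_\<sigma>])

text \<open>
  For spaces \<open>X i\<close> compatible with the maps of \<open>M\<close>, the subrepresentation of \<open>M\<close> that they form.
\<close>

definition family :: "('v, 'e, 'b) rep \<Rightarrow> (nat \<Rightarrow> 'b set) \<Rightarrow> ('v, 'e, 'b) rep" where
  "family M X = \<lparr>rspace = \<lambda>v. X (idx v), rmap = rmap M\<rparr>"

lemma rspace_family [simp]: "i \<in> {1..n} \<Longrightarrow> rspace (family M X) (\<sigma> i) = X i"
  by (simp add: family_def)

lemma rmap_family [simp]: "rmap (family M X) = rmap M"
  by (simp add: family_def)

lemma subspace_finite_span:
  assumes "subspace U" "U \<subseteq> span B" "finite B"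
  shows "\<exists>C. finite C \<and> span C = U"
proof -
  obtain C where C: "C \<subseteq> U" "independent C" "U \<subseteq> span C"
    by (metis basis_exists)
  have "finite C" using independent_span_bound[OF assms(3) C(2)] C(1) assms(2) by auto
  then show ?thesis using span_subspace[OF C(1,3) assms(1)] by blast
qed

lemma subspace_dim_pos:
  assumes "subspace U" "U \<subseteq> span B" "finite B" "U \<noteq> {0}"
  shows "0 < dim U"
proof (rule ccontr)
  assume "\<not> 0 < dim U"
  obtain C where C: "C \<subseteq> U" "independent C" "U \<subseteq> span C" "card C = dim U"
    by (metis basis_exists)
  have "finite C" using independent_span_bound[OF assms(3) C(2)] C(1) assms(2) by auto
  then have "C = {}" using C(4) \<open>\<not> 0 < dim U\<close> by simp
  then show False using C(3) assms(4) subspace_0[OF assms(1)] by auto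
qed

lemma subspace_of_line:
  assumes "subspace U" "U \<subseteq> span {y}"
  shows "U = {0} \<or> U = span {y}"
proof (cases "U = {0}")
  case False
  then obtain u where u: "u \<in> U" "u \<noteq> 0" using subspace_0[OF assms(1)] by blast
  then obtain k where k: "u = k *s y" using assms(2) by (auto simp: span_singleton)
  with u(2) have "k \<noteq> 0" by auto
  then have "y = inverse k *s u" using k by simp
  then have "y \<in> U" using u(1) assms(1) subspace_scale by metis
  then have "span {y} \<subseteq> U" using assms(1) by (intro span_minimal) auto
  then show ?thesis using assms(2) by blast
qed simp

lemma dim_line: "y \<noteq> 0 \<Longrightarrow> dim (span {y}) = 1"
  by (simp add: dim_eq_card_independent)

lemma dim_zero_space: "dim {0} = 0"
  using dim_span_eq_card_independent[of "{}"] by (simp add: independent_empty)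

lemma is_rep_spaces:
  assumes "is_rep Q M" "i \<in> {1..n}"
  shows "subspace (rspace M (\<sigma> i))" "\<exists>B. finite B \<and> span B = rspace M (\<sigma> i)"
  using assms unfolding is_rep_def by auto

lemma zigzag_of_rep:
  assumes "is_rep Q M"
  shows "zigzag scale n fwd (\<lambda>i. rspace M (\<sigma> i)) (\<lambda>i. rmap M (\<tau> i))"
proof
  show "subspace (rspace M (\<sigma> i))" if "i \<in> {1..n}" for i
    using is_rep_spaces[OF assms that] by blast
  fix i assume i: "i \<in> {1..<n}"
  note maps = assms[unfolded is_rep_def, THEN conjunct2, rule_format, OF \<tau>_in[OF i],
      unfolded tail_head[OF i]]
  show "rmap M (\<tau> i) x \<in> rspace M (\<sigma> (tgt i))" if "x \<in> rspace M (\<sigma> (src i))" for x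
    using maps that by blast
  show "rmap M (\<tau> i) (x + y) = rmap M (\<tau> i) x + rmap M (\<tau> i) y"
    if "x \<in> rspace M (\<sigma> (src i))" "y \<in> rspace M (\<sigma> (src i))" for x y
    using maps that by blast
  show "rmap M (\<tau> i) (k *s x) = k *s rmap M (\<tau> i) x" if "x \<in> rspace M (\<sigma> (src i))" for k x
    using maps that by blast
qed

lemma subrep_family:
  assumes M: "is_rep Q M"
    and X: "\<And>i. i \<in> {1..n} \<Longrightarrow> subspace (X i) \<and> X i \<subseteq> rspace M (\<sigma> i)"
    and maps: "\<And>i. i \<in> {1..<n} \<Longrightarrow> rmap M (\<tau> i) ` X (src i) \<subseteq> X (tgt i)"
  shows "subrep Q (family M X) M"
proof -
  interpret zigzag scale n fwd "\<lambda>i. rspace M (\<sigma> i)" "\<lambda>i. rmap M (\<tau> i)"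
    by (rule zigzag_of_rep[OF M])
  have "is_rep Q (family M X)"
    unfolding is_rep_def
  proof (intro conjI ballI)
    fix v assume "v \<in> verts Q"
    then obtain i where i: "i \<in> {1..n}" "v = \<sigma> i" by (auto simp: verts_eq)
    show "subspace (rspace (family M X) v)" using i X by simp
    obtain B where "finite B" "span B = rspace M (\<sigma> i)" using is_rep_spaces(2)[OF M i(1)] by blast
    then show "\<exists>B. finite B \<and> span B = rspace (family M X) v"
      using subspace_finite_span[of "X i" B] X i by simp
  next
    fix a assume "a \<in> arcs Q"
    then obtain i where i: "i \<in> {1..<n}" "a = \<tau> i" by (auto simp: arcs_eq)
    note s = src_tgt_in[OF i(1)]
    have sub: "X (src i) \<subseteq> rspace M (\<sigma> (src i))" using X[OF s(1)] by blast
    show "rmap (family M X) a ` rspace (family M X) (tail Q a) \<subseteq> rspace (family M X) (head Q a)"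
      using maps[OF i(1)] i s tail_head[OF i(1)] by simp
    show "rmap (family M X) a (x + y) = rmap (family M X) a x + rmap (family M X) a y"
      if "x \<in> rspace (family M X) (tail Q a)" "y \<in> rspace (family M X) (tail Q a)" for x y
      using f_add[OF i(1), of x y] that sub i s tail_head[OF i(1)] by auto
    show "\<forall>c. \<forall>x\<in>rspace (family M X) (tail Q a).
        rmap (family M X) a (c *s x) = c *s rmap (family M X) a x"
    proof (intro allI ballI)
      fix c x assume "x \<in> rspace (family M X) (tail Q a)"
      then show "rmap (family M X) a (c *s x) = c *s rmap (family M X) a x"
        using f_scale[OF i(1), of x c] sub i s tail_head[OF i(1)] by auto
    qed
  qed
  then show ?thesis
    unfolding subrep_def using X by (auto simp: verts_eq)
qed

definition interval_rep :: "('v, 'e, 'b) rep \<Rightarrow> nat \<Rightarrow> nat \<Rightarrow> (nat \<Rightarrow> 'b) \<Rightarrow> bool" where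
  "interval_rep M a b y \<longleftrightarrow> is_rep Q M \<and> 1 \<le> a \<and> a \<le> b \<and> b \<le> n
    \<and> (\<forall>i\<in>{a..b}. y i \<noteq> 0 \<and> rspace M (\<sigma> i) = span {y i})
    \<and> (\<forall>i\<in>{1..n} - {a..b}. rspace M (\<sigma> i) = {0})
    \<and> (\<forall>i\<in>{a..<b}. rmap M (\<tau> i) (y (src i)) = y (tgt i))"

lemma interval_repD:
  assumes "interval_rep M a b y"
  shows "is_rep Q M" "1 \<le> a" "a \<le> b" "b \<le> n"
    and "i \<in> {a..b} \<Longrightarrow> y i \<noteq> 0"
    and "i \<in> {a..b} \<Longrightarrow> rspace M (\<sigma> i) = span {y i}"
    and "i \<in> {1..n} \<Longrightarrow> i \<notin> {a..b} \<Longrightarrow> rspace M (\<sigma> i) = {0}"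
    and "i \<in> {a..<b} \<Longrightarrow> rmap M (\<tau> i) (y (src i)) = y (tgt i)"
  using assms by (simp_all add: interval_rep_def)

text \<open>
  Split off an interval module at the leftmost vertex \<open>a\<close> of the support.  Nothing lives to the left of
  \<open>a\<close>, so the decomposition of the restriction to \<open>{a..n}\<close> is one of the whole representation,
  and indecomposability kills the complement.
\<close>

lemma indecomposable_imp_interval_rep:
  assumes "indecomposable Q M"
  shows "\<exists>a b y. interval_rep M a b y"
proof -
  have M: "is_rep Q M" and nz: "nonzero Q M"
    and ind: "\<And>N1 N2. direct_sum Q M N1 N2 \<Longrightarrow> nonzero Q N1 \<Longrightarrow> \<not> nonzero Q N2"
    using assms unfolding indecomposable_def by auto
  define V where "V i = rspace M (\<sigma> i)" for i
  define f where "f i = rmap M (\<tau> i)" for i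
  interpret zigzag scale n fwd V f
    using zigzag_of_rep[OF M] unfolding V_def f_def .
  define P where "P i \<longleftrightarrow> i \<in> {1..n} \<and> V i \<noteq> {0}" for i
  define a where "a = (LEAST i. P i)"
  have "\<exists>i. P i" using nz by (auto simp: nonzero_def P_def V_def verts_eq)
  then have Pa: "P a" unfolding a_def by (rule LeastI_ex)
  have before: "V i = {0}" if "i \<in> {1..n}" "i < a" for i
    using not_less_Least[of i P] that by (auto simp: a_def P_def)
  have a: "1 \<le> a" "a \<le> n" "V a \<noteq> {0}" using Pa by (auto simp: P_def)
  obtain x H where "interval_summand a x H" using interval_summand_exists[OF a] by blast
  then obtain b y K where ab: "a \<le> b" "b \<le> n"
    and compl: "\<forall>i\<in>{a..b}. complements (V i) (y i) (K i)"
    and after: "\<forall>i\<in>{b<..n}. y i = 0 \<and> K i = V i"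
    and K_map: "\<forall>i\<in>{a..<n}. f i ` K (src i) \<subseteq> K (tgt i)"
    and y_map: "\<forall>i\<in>{a..<b}. f i (y (src i)) = y (tgt i)"
    and stop: "b < n \<longrightarrow> fwd b \<longrightarrow> f b (y b) = 0"
    unfolding interval_summand_def by (elim exE conjE) (rule that)
  note compl = bspec[OF compl] and after = bspec[OF after] and K_map = bspec[OF K_map]
    and y_map = bspec[OF y_map] and stop = stop[rule_format]
  define X1 where "X1 i = (if i \<in> {a..b} then span {y i} else {0})" for i
  define X2 where "X2 i = (if i < a then {0} else K i)" for i
  have V0: "0 \<in> V i" if "i \<in> {1..n}" for i using subspace_0[OF subspace_V[OF that]] .
  have X1: "subspace (X1 i) \<and> X1 i \<subseteq> V i" if i: "i \<in> {1..n}" for i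
  proof -
    have "span {y i} \<subseteq> V i" if "i \<in> {a..b}"
      using compl[OF that] subspace_V[OF i] by (intro span_minimal) (auto simp: complements_def)
    then show ?thesis using V0[OF i] by (auto simp: X1_def)
  qed
  have X2: "subspace (X2 i) \<and> X2 i \<subseteq> V i" if i: "i \<in> {1..n}" for i
  proof -
    consider "i < a" | "i \<in> {a..b}" | "i \<in> {b<..n}" using i by fastforce
    then show ?thesis
    proof cases
      case 2
      then show ?thesis using compl[OF 2] by (auto simp: X2_def complements_def)
    next
      case 3
      then show ?thesis using after[OF 3] subspace_V[OF i] ab by (auto simp: X2_def)
    qed (use V0[OF i] in \<open>auto simp: X2_def\<close>)
  qed
  have s1: "subrep Q (family M X1) M"
  proof (rule subrep_family[OF M])
    show "subspace (X1 i) \<and> X1 i \<subseteq> rspace M (\<sigma> i)" if "i \<in> {1..n}" for i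
      using X1[OF that] by (simp add: V_def)
    fix i assume i: "i \<in> {1..<n}"
    note st = src_tgt_in[OF i]
    have "f i ` X1 (src i) \<subseteq> X1 (tgt i)"
    proof (cases "src i \<in> {a..b}")
      case src: True
      then have yV: "y (src i) \<in> V (src i)" using compl by (auto simp: complements_def)
      have img: "f i ` X1 (src i) \<subseteq> span {f i (y (src i))}"
        using src f_scale[OF i yV] by (auto simp: X1_def span_singleton)
      have tV: "f i ` X1 (src i) \<subseteq> V (tgt i)" using X1[OF st(1)] f_in[OF i] by auto
      consider "tgt i < a" | "tgt i \<in> {a..b}" | "b < tgt i" by fastforce
      then show ?thesis
      proof cases
        case 1
        then show ?thesis using tV before[OF st(2)] by (auto simp: X1_def)
      next
        case 2
        then have "i \<in> {a..<b}" using src by (auto simp: arrow_ends split: if_splits)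
        then show ?thesis using img y_map 2 by (simp add: X1_def)
      next
        case 3
        then have "i = b" using src by (auto simp: arrow_ends split: if_splits)
        then have ib: "i = b" "fwd b" using 3 src by (auto simp: arrow_ends split: if_splits)
        then have "f i (y (src i)) = 0" using stop i by (auto simp: arrow_ends)
        then show ?thesis using img 3 by (simp add: X1_def)
      qed
    next
      case False
      have "0 \<in> X1 (tgt i)" using X1[OF st(2)] subspace_0 by blast
      moreover have "X1 (src i) = {0}" using False unfolding X1_def by (rule if_not_P)
      ultimately show ?thesis using f_0[OF i] by simp
    qed
    then show "rmap M (\<tau> i) ` X1 (src i) \<subseteq> X1 (tgt i)" by (simp add: f_def)
  qed
  have s2: "subrep Q (family M X2) M"
  proof (rule subrep_family[OF M])
    show "subspace (X2 i) \<and> X2 i \<subseteq> rspace M (\<sigma> i)" if "i \<in> {1..n}" for i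
      using X2[OF that] by (simp add: V_def)
    fix i assume i: "i \<in> {1..<n}"
    note st = src_tgt_in[OF i]
    have "f i ` X2 (src i) \<subseteq> X2 (tgt i)"
    proof -
      have tV: "f i ` X2 (src i) \<subseteq> V (tgt i)" using X2[OF st(1)] f_in[OF i] by auto
      consider "tgt i < a" | "src i < a" | "a \<le> src i" "a \<le> tgt i" by fastforce
      then show ?thesis
      proof cases
        case 1
        then show ?thesis using tV before[OF st(2)] by (auto simp: X2_def)
      next
        case 2
        have "0 \<in> X2 (tgt i)" using X2[OF st(2)] subspace_0 by blast
        then show ?thesis using 2 f_0[OF i] by (simp add: X2_def[of "src i"])
      next
        case 3
        then have "i \<in> {a..<n}" using i by (auto simp: arrow_ends split: if_splits)
        then show ?thesis using K_map 3 by (simp add: X2_def)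
      qed
    qed
    then show "rmap M (\<tau> i) ` X2 (src i) \<subseteq> X2 (tgt i)" by (simp add: f_def)
  qed
  have dec: "X1 i \<inter> X2 i = {0} \<and> V i = {u + h | u h. u \<in> X1 i \<and> h \<in> X2 i}"
    if i: "i \<in> {1..n}" for i
  proof -
    consider "i < a" | "i \<in> {a..b}" | "i \<in> {b<..n}" using i by fastforce
    then show ?thesis
    proof cases
      case 1
      then show ?thesis using before[OF i] by (auto simp: X1_def X2_def)
    next
      case 2
      then show ?thesis using complements_span[OF compl[OF 2] subspace_V[OF i]]
        by (simp add: X1_def X2_def)
    next
      case 3
      then show ?thesis using after[OF 3] V0[OF i] ab by (auto simp: X1_def X2_def)
    qed
  qed
  have "direct_sum Q M (family M X1) (family M X2)"
    unfolding direct_sum_def using s1 s2 dec by (auto simp: verts_eq V_def)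
  moreover have "nonzero Q (family M X1)"
  proof -
    have "y a \<in> X1 a" using ab by (simp add: X1_def span_base)
    moreover have "y a \<noteq> 0" using complements_nonzero[OF compl] ab by auto
    ultimately show ?thesis unfolding nonzero_def using a by (auto simp: verts_eq)
  qed
  ultimately have "\<not> nonzero Q (family M X2)" using ind by blast
  then have X2_0: "X2 i = {0}" if "i \<in> {1..n}" for i
    using that by (auto simp: nonzero_def verts_eq)
  have VX1: "V i = X1 i" if "i \<in> {1..n}" for i
    using dec[OF that] X2_0[OF that] by auto
  have "interval_rep M a b y"
    unfolding interval_rep_def
  proof (intro conjI ballI)
    show "y i \<noteq> 0" if "i \<in> {a..b}" for i using complements_nonzero[OF compl[OF that]] .
    show "rspace M (\<sigma> i) = span {y i}" if "i \<in> {a..b}" for i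
      using VX1[of i] that a ab by (auto simp: V_def X1_def)
    show "rspace M (\<sigma> i) = {0}" if "i \<in> {1..n} - {a..b}" for i
      using VX1[of i] that by (auto simp: V_def X1_def)
    show "rmap M (\<tau> i) (y (src i)) = y (tgt i)" if "i \<in> {a..<b}" for i
      using y_map[OF that] by (simp add: f_def)
  qed (use M a ab in auto)
  then show ?thesis by blast
qed

section \<open>Subrepresentations and stability of interval modules\<close>

definition support :: "('v, 'e, 'b) rep \<Rightarrow> nat set" where
  "support M = {i \<in> {1..n}. rspace M (\<sigma> i) \<noteq> {0}}"

lemma support_interval_rep: "interval_rep M a b y \<Longrightarrow> support M = {a..b}"
  unfolding interval_rep_def support_def
  using span_base[of _ "{_}"] by fastforce

lemma subrep_interval_spaces:
  assumes M: "interval_rep M a b y" and N: "subrep Q N M"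
  shows "support N \<subseteq> {a..b}"
    and "i \<in> {1..n} \<Longrightarrow> rspace N (\<sigma> i) = (if i \<in> support N then span {y i} else {0})"
    and "i \<in> {a..b} \<Longrightarrow> i \<in> support N \<longleftrightarrow> y i \<in> rspace N (\<sigma> i)"
proof -
  have sub: "subspace (rspace N (\<sigma> i)) \<and> rspace N (\<sigma> i) \<subseteq> rspace M (\<sigma> i)" if "i \<in> {1..n}" for i
    using N that unfolding subrep_def is_rep_def by auto
  have 0: "0 \<in> rspace N (\<sigma> i)" if "i \<in> {1..n}" for i using subspace_0 sub[OF that] by blast
  have out: "rspace N (\<sigma> i) = {0}" if "i \<in> {1..n}" "i \<notin> {a..b}" for i
    using interval_repD(7)[OF M that] sub[OF that(1)] 0[OF that(1)] by auto
  show supp: "support N \<subseteq> {a..b}" using out unfolding support_def by blast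
  show *: "rspace N (\<sigma> i) = (if i \<in> support N then span {y i} else {0})" if "i \<in> {1..n}" for i
  proof (cases "i \<in> support N")
    case True
    then have "i \<in> {a..b}" using supp by blast
    then have "rspace M (\<sigma> i) = span {y i}" by (rule interval_repD(6)[OF M])
    then have "rspace N (\<sigma> i) = {0} \<or> rspace N (\<sigma> i) = span {y i}"
      using subspace_of_line sub[OF that] by metis
    then show ?thesis using True by (auto simp: support_def)
  next
    case False
    then show ?thesis using that by (simp add: support_def)
  qed
  show "i \<in> support N \<longleftrightarrow> y i \<in> rspace N (\<sigma> i)" if i: "i \<in> {a..b}"
  proof -
    have "i \<in> {1..n}" "y i \<noteq> 0" using interval_repD[OF M] i by auto
    then show ?thesis using *[of i] span_base[of "y i" "{y i}"] by auto
  qed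
qed

lemma subrep_support_closed:
  assumes M: "interval_rep M a b y" and N: "subrep Q N M" and c: "c \<in> {a..<b}"
    and s: "src c \<in> support N"
  shows "tgt c \<in> support N"
proof -
  have ab: "1 \<le> a" "b \<le> n" using interval_repD[OF M] by auto
  have c': "c \<in> {1..<n}" and st: "src c \<in> {a..b}" "tgt c \<in> {a..b}"
    using c ab by (auto simp: arrow_ends)
  have y: "y (src c) \<in> rspace N (\<sigma> (src c))"
    using subrep_interval_spaces(3)[OF M N st(1)] s by simp
  have "rmap N (\<tau> c) (y (src c)) \<in> rspace N (\<sigma> (tgt c))"
    using zigzag.f_in[OF zigzag_of_rep c' y] N unfolding subrep_def by blast
  moreover have "rmap N (\<tau> c) (y (src c)) = rmap M (\<tau> c) (y (src c))"
    using N y c' tail_head[OF c'] unfolding subrep_def by simp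
  moreover have "\<dots> = y (tgt c)" by (rule interval_repD(8)[OF M c])
  ultimately show ?thesis using subrep_interval_spaces(3)[OF M N st(2)] by simp
qed

text \<open>
  The supports of the two summands partition \<open>{a..b}\<close>, and both are closed under successors.
  Neither can therefore change across an arrow inside \<open>{a..b}\<close>, so one of them is empty.
\<close>

lemma interval_rep_indecomposable:
  assumes M: "interval_rep M a b y"
  shows "indecomposable Q M"
proof -
  have ab: "1 \<le> a" "a \<le> b" "b \<le> n" and rep: "is_rep Q M" using interval_repD[OF M] by auto
  have nonzero_iff: "nonzero Q N \<longleftrightarrow> support N \<noteq> {}" for N :: "('v, 'e, 'b) rep"
    by (auto simp: nonzero_def support_def verts_eq)
  have False if D: "direct_sum Q M N1 N2" and nz: "nonzero Q N1" "nonzero Q N2" for N1 N2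
  proof -
    have s1: "subrep Q N1 M" and s2: "subrep Q N2 M"
      and inter: "\<And>i. i \<in> {1..n} \<Longrightarrow> rspace N1 (\<sigma> i) \<inter> rspace N2 (\<sigma> i) = {0}"
      and sum: "\<And>i. i \<in> {1..n} \<Longrightarrow> rspace M (\<sigma> i)
        = {x + y | x y. x \<in> rspace N1 (\<sigma> i) \<and> y \<in> rspace N2 (\<sigma> i)}"
      using D unfolding direct_sum_def by auto
    have excl: "i \<in> support N1 \<longleftrightarrow> i \<notin> support N2" if i: "i \<in> {a..b}" for i
    proof -
      have i': "i \<in> {1..n}" using i ab by auto
      have yi: "y i \<noteq> 0" "rspace M (\<sigma> i) = span {y i}" using interval_repD[OF M] i by auto
      have "i \<in> support N1 \<Longrightarrow> i \<in> support N2 \<Longrightarrow> False"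
        using inter[OF i'] subrep_interval_spaces(3)[OF M s1 i]
          subrep_interval_spaces(3)[OF M s2 i] yi by blast
      moreover have "i \<in> support N1 \<or> i \<in> support N2"
      proof (rule ccontr)
        assume "\<not> ?thesis"
        then have "rspace N1 (\<sigma> i) = {0}" "rspace N2 (\<sigma> i) = {0}" using i' by (auto simp: support_def)
        then have "span {y i} = {0}" using sum[OF i'] yi by auto
        then show False using yi span_base[of "y i" "{y i}"] by auto
      qed
      ultimately show ?thesis by blast
    qed
    have cross: "c \<in> support N1 \<longleftrightarrow> c + 1 \<in> support N1" if c: "c \<in> {a..<b}" for c
    proof -
      have st: "src c \<in> {a..b}" "tgt c \<in> {a..b}" using c by (auto simp: arrow_ends)
      have "src c \<in> support N1 \<longleftrightarrow> tgt c \<in> support N1"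
        using subrep_support_closed[OF M s1 c] subrep_support_closed[OF M s2 c]
          excl[OF st(1)] excl[OF st(2)] by blast
      then show ?thesis by (cases "fwd c") (auto simp: arrow_ends)
    qed
    have const: "i \<in> support N1 \<longleftrightarrow> a \<in> support N1" if i: "i \<in> {a..b}" for i
    proof -
      have "a \<le> i" "i \<le> b" using i by auto
      then show ?thesis
      proof (induction i rule: dec_induct)
        case (step m)
        then show ?case using cross[of m] by auto
      qed simp
    qed
    obtain i j where "i \<in> support N1" "j \<in> support N2" using nz nonzero_iff by blast
    then show False
      using const[of i] const[of j] excl[of j] subrep_interval_spaces(1)[OF M s1]
        subrep_interval_spaces(1)[OF M s2] by blast
  qed
  moreover have "nonzero Q M"
    using nonzero_iff support_interval_rep[OF M] ab by simp
  ultimately show ?thesis unfolding indecomposable_def using rep by blast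
qed

lemma interval_rep_exists:
  assumes ab: "1 \<le> a" "a \<le> b" "b \<le> n"
  shows "\<exists>M y. interval_rep M a b y"
proof -
  obtain u :: 'b where u: "u \<noteq> 0"
    using infinite_dimensional span_empty by (metis UNIV_eq_I finite.emptyI singletonI)
  define M :: "('v, 'e, 'b) rep" where "M =
    \<lparr>rspace = \<lambda>v. if idx v \<in> {a..b} then span {u} else {0},
     rmap = \<lambda>e x. if idx (tail Q e) \<in> {a..b} \<and> idx (head Q e) \<in> {a..b} then x else 0\<rparr>"
  have "is_rep Q M"
    unfolding is_rep_def
  proof (intro conjI ballI)
    fix v
    show "subspace (rspace M v)" by (simp add: M_def)
    show "\<exists>B. finite B \<and> span B = rspace M v"
      by (cases "idx v \<in> {a..b}") (auto simp: M_def intro: exI[of _ "{u}"] exI[of _ "{}"])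
  next
    fix e
    show "rmap M e ` rspace M (tail Q e) \<subseteq> rspace M (head Q e)"
      using span_zero by (auto simp: M_def)
    show "rmap M e (x + y) = rmap M e x + rmap M e y" for x y
      by (simp add: M_def)
    show "\<forall>c. \<forall>x\<in>rspace M (tail Q e). rmap M e (c *s x) = c *s rmap M e x"
      by (auto simp: M_def)
  qed
  moreover have "rmap M (\<tau> i) u = u" if i: "i \<in> {a..<b}" for i
  proof -
    have "i \<in> {1..<n}" using i ab by auto
    moreover have "src i \<in> {a..b}" "tgt i \<in> {a..b}" using i by (auto simp: arrow_ends)
    ultimately show ?thesis using tail_head src_tgt_in by (simp add: M_def)
  qed
  ultimately have "interval_rep M a b (\<lambda>_. u)"
    unfolding interval_rep_def using u ab by (auto simp: M_def)
  then show ?thesis by blast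
qed

lemma subrep_with_support:
  assumes M: "interval_rep M a b y" and S: "S \<subseteq> {a..b}" "successor_closed fwd a b S"
  shows "\<exists>N. subrep Q N M \<and> support N = S"
proof -
  have ab: "1 \<le> a" "a \<le> b" "b \<le> n" and rep: "is_rep Q M" using interval_repD[OF M] by auto
  interpret zigzag scale n fwd "\<lambda>i. rspace M (\<sigma> i)" "\<lambda>i. rmap M (\<tau> i)"
    by (rule zigzag_of_rep[OF rep])
  define X where "X i = (if i \<in> S then rspace M (\<sigma> i) else {0})" for i
  have X: "subspace (X i) \<and> X i \<subseteq> rspace M (\<sigma> i)" if "i \<in> {1..n}" for i
    using subspace_V[OF that] subspace_0 by (auto simp: X_def)
  have "subrep Q (family M X) M"
  proof (rule subrep_family[OF rep X])
    fix i assume i: "i \<in> {1..<n}"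
    note st = src_tgt_in[OF i]
    show "rmap M (\<tau> i) ` X (src i) \<subseteq> X (tgt i)"
    proof (cases "src i \<in> S \<and> tgt i \<notin> S")
      case True
      then have "src i \<in> {a..b}" using S by blast
      have "tgt i \<notin> {a..b}"
      proof
        assume "tgt i \<in> {a..b}"
        with \<open>src i \<in> {a..b}\<close> have "i \<in> {a..<b}" by (auto simp: arrow_ends split: if_splits)
        then show False using S(2) True unfolding successor_closed_def by blast
      qed
      then have "rspace M (\<sigma> (tgt i)) = {0}" by (rule interval_repD(7)[OF M st(2)])
      moreover have "rmap M (\<tau> i) ` X (src i) \<subseteq> rspace M (\<sigma> (tgt i))"
        using X[OF st(1)] f_in[OF i] by auto
      moreover have "0 \<in> X (tgt i)" using X[OF st(2)] subspace_0 by blast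
      ultimately show ?thesis by auto
    next
      case False
      show ?thesis
      proof (cases "src i \<in> S")
        case True
        then show ?thesis using False f_in[OF i] by (auto simp: X_def)
      next
        case F: False
        have "0 \<in> X (tgt i)" using X[OF st(2)] subspace_0 by blast
        then show ?thesis using F f_0[OF i] by (simp add: X_def[of "src i"])
      qed
    qed
  qed
  moreover have "support (family M X) = S"
  proof -
    have "i \<in> support (family M X) \<longleftrightarrow> i \<in> support M \<inter> S" for i
      by (cases "i \<in> {1..n}"; cases "i \<in> S") (simp_all add: support_def X_def del: atLeastAtMost_iff)
    then have "support (family M X) = support M \<inter> S" by blast
    then show ?thesis using S(1) support_interval_rep[OF M] by (simp add: Int_absorb1)
  qed
  ultimately show ?thesis by blast
qed

lemma central_charge_support:
  assumes M: "interval_rep M a b y" and N: "subrep Q N M"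
  shows "central_charge Q w r (dimvec Q N)
    = Complex (\<Sum>i\<in>support N. w (\<sigma> i)) (\<Sum>i\<in>support N. r (\<sigma> i))"
proof -
  have dim: "dim (rspace N (\<sigma> i)) = (if i \<in> support N then 1 else 0)" if i: "i \<in> {1..n}" for i
  proof -
    have "y i \<noteq> 0" if "i \<in> support N"
      using that interval_repD(5)[OF M] subrep_interval_spaces(1)[OF M N] by blast
    then show ?thesis
      using subrep_interval_spaces(2)[OF M N i] dim_line dim_zero_space by simp
  qed
  have "(\<Sum>v\<in>verts Q. g v * of_int (dimvec Q N v)) = (\<Sum>i\<in>support N. g (\<sigma> i))" for g :: "'v \<Rightarrow> real"
  proof -
    have "(\<Sum>v\<in>verts Q. g v * of_int (dimvec Q N v))
      = (\<Sum>i\<in>{1..n}. g (\<sigma> i) * of_int (dimvec Q N (\<sigma> i)))"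
      using sum.reindex_bij_betw[OF bij_\<sigma>, of "\<lambda>v. g v * of_int (dimvec Q N v)"] by simp
    also have "\<dots> = (\<Sum>i\<in>{1..n}. if i \<in> support N then g (\<sigma> i) else 0)"
      by (rule sum.cong) (auto simp: dimvec_def dim)
    also have "\<dots> = (\<Sum>i\<in>{i\<in>{1..n}. i \<in> support N}. g (\<sigma> i))"
      by (rule sum.inter_filter[symmetric]) simp
    also have "{i\<in>{1..n}. i \<in> support N} = support N" by (auto simp: support_def)
    finally show ?thesis .
  qed
  then show ?thesis by (simp add: central_charge_def)
qed

lemma subrep_refl: "is_rep Q M \<Longrightarrow> subrep Q M M"
  by (simp add: subrep_def)

text \<open>
  A subrepresentation of an interval module is determined by its support, so stability turns into
  a condition on the successor-closed subsets of \<open>{a..b}\<close>.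
\<close>

lemma stable_interval_iff:
  assumes M: "interval_rep M a b y"
  shows "stable Q (central_charge Q w r) M \<longleftrightarrow>
    (\<forall>S. S \<subset> {a..b} \<and> S \<noteq> {} \<and> successor_closed fwd a b S \<longrightarrow>
      (\<Sum>i\<in>S. w (\<sigma> i)) / (\<Sum>i\<in>S. r (\<sigma> i))
      < (\<Sum>i=a..b. w (\<sigma> i)) / (\<Sum>i=a..b. r (\<sigma> i)))"
proof -
  let ?Z = "central_charge Q w r"
  have rep: "is_rep Q M" using interval_repD[OF M] by auto
  have slope: "slope Q ?Z N = (\<Sum>i\<in>support N. w (\<sigma> i)) / (\<Sum>i\<in>support N. r (\<sigma> i))"
    if "subrep Q N M" for N
    unfolding slope_def central_charge_support[OF M that] by simp
  have slopeM: "slope Q ?Z M = (\<Sum>i=a..b. w (\<sigma> i)) / (\<Sum>i=a..b. r (\<sigma> i))"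
    using slope[OF subrep_refl[OF rep]] support_interval_rep[OF M] by simp
  have nonzero_iff: "nonzero Q N \<longleftrightarrow> support N \<noteq> {}" for N :: "('v, 'e, 'b) rep"
    by (auto simp: nonzero_def support_def verts_eq)
  have proper_iff: "proper_subrep Q N M \<longleftrightarrow> support N \<subset> {a..b}" if N: "subrep Q N M" for N
  proof -
    have "(\<exists>v\<in>verts Q. rspace N v \<noteq> rspace M v) \<longleftrightarrow> support N \<noteq> support M"
    proof
      assume "\<exists>v\<in>verts Q. rspace N v \<noteq> rspace M v"
      then obtain i where "i \<in> {1..n}" "rspace N (\<sigma> i) \<noteq> rspace M (\<sigma> i)"
        unfolding verts_eq by blast
      then show "support N \<noteq> support M"
        using subrep_interval_spaces(2)[OF M N, of i]
          subrep_interval_spaces(2)[OF M subrep_refl[OF rep], of i] by auto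
    qed (auto simp: support_def verts_eq)
    then show ?thesis
      unfolding proper_subrep_def using N support_interval_rep[OF M] subrep_interval_spaces(1)[OF M N]
      by blast
  qed
  show ?thesis
    unfolding stable_def slopeM
  proof (intro iffI allI impI; elim conjE)
    fix S
    assume st: "\<forall>N. proper_subrep Q N M \<and> nonzero Q N \<longrightarrow>
        slope Q ?Z N < (\<Sum>i=a..b. w (\<sigma> i)) / (\<Sum>i=a..b. r (\<sigma> i))"
      and S: "S \<subset> {a..b}" "S \<noteq> {}" "successor_closed fwd a b S"
    obtain N where "subrep Q N M" "support N = S" using subrep_with_support[OF M _ S(3)] S(1) by blast
    then show "(\<Sum>i\<in>S. w (\<sigma> i)) / (\<Sum>i\<in>S. r (\<sigma> i))
        < (\<Sum>i=a..b. w (\<sigma> i)) / (\<Sum>i=a..b. r (\<sigma> i))"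
      using st[rule_format, of N] slope[of N] proper_iff[of N] nonzero_iff[of N] S by simp
  next
    fix N
    assume st: "\<forall>S. S \<subset> {a..b} \<and> S \<noteq> {} \<and> successor_closed fwd a b S \<longrightarrow>
        (\<Sum>i\<in>S. w (\<sigma> i)) / (\<Sum>i\<in>S. r (\<sigma> i))
        < (\<Sum>i=a..b. w (\<sigma> i)) / (\<Sum>i=a..b. r (\<sigma> i))"
      and N: "proper_subrep Q N M" "nonzero Q N"
    have s: "subrep Q N M" using N(1) unfolding proper_subrep_def by blast
    have "successor_closed fwd a b (support N)"
      unfolding successor_closed_def using subrep_support_closed[OF M s] by blast
    then show "slope Q ?Z N < (\<Sum>i=a..b. w (\<sigma> i)) / (\<Sum>i=a..b. r (\<sigma> i))"
      using st slope[OF s] proper_iff[OF s] nonzero_iff N by simp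
  qed
qed

lemma central_charge_stability_condition:
  assumes "\<And>v. v \<in> verts Q \<Longrightarrow> 0 < r v"
  shows "stability_condition Q (central_charge Q w r)"
  unfolding stability_condition_def
proof (intro conjI ballI allI impI)
  show "central_charge Q w r (\<lambda>v. x v + y v) = central_charge Q w r x + central_charge Q w r y" for x y
    by (simp add: central_charge_def sum.distrib algebra_simps complex_eq_iff)
  fix M :: "('v, 'e, 'b) rep" assume M: "is_rep Q M \<and> nonzero Q M"
  then obtain v where v: "v \<in> verts Q" "rspace M v \<noteq> {0}" by (auto simp: nonzero_def)
  obtain B where "finite B" "span B = rspace M v" "subspace (rspace M v)"
    using M v(1) unfolding is_rep_def by blast
  then have "0 < dim (rspace M v)" using subspace_dim_pos[of "rspace M v" B] v(2) by auto
  then have "0 < r v * of_int (dimvec Q M v)" using assms[OF v(1)] v(1) by (simp add: dimvec_def)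
  moreover have "finite (verts Q)" by (simp add: verts_eq)
  moreover have "0 \<le> r u * of_int (dimvec Q M u)" if "u \<in> verts Q" for u
    using assms[OF that] by (simp add: dimvec_def)
  ultimately have "0 < (\<Sum>u\<in>verts Q. r u * of_int (dimvec Q M u))"
    using v(1) by (intro sum_pos2)
  then show "0 < Im (central_charge Q w r (dimvec Q M))" by (simp add: central_charge_def)
qed

section \<open>Total stability as convex position\<close>

definition partial_sum :: "('v \<Rightarrow> real) \<Rightarrow> nat \<Rightarrow> real" where
  "partial_sum w k = (\<Sum>i=1..k. w (\<sigma> i))"

lemma partial_sum_0 [simp]: "partial_sum w 0 = 0"
  by (simp add: partial_sum_def)

lemma partial_sum_diff: "a \<le> b \<Longrightarrow> 1 \<le> a \<Longrightarrow> partial_sum w b - partial_sum w (a - 1) = (\<Sum>i=a..b. w (\<sigma> i))"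
proof (induction b rule: dec_induct)
  case base
  then show ?case by (cases a) (auto simp: partial_sum_def)
next
  case (step m)
  then show ?case by (simp add: partial_sum_def)
qed

lemma partial_sum_step: "1 \<le> i \<Longrightarrow> partial_sum w i - partial_sum w (i - 1) = w (\<sigma> i)"
  using partial_sum_diff[of i i] by simp

lemma heights_partial_sum:
  assumes "r \<in> pos_orthant (verts Q)"
  shows "heights n (partial_sum r)"
proof
  fix i j assume ij: "i < j" "j \<le> n"
  have "0 < (\<Sum>l=i + 1..j. r (\<sigma> l))"
    by (rule sum_pos) (use ij assms in \<open>auto simp: pos_orthant_def\<close>)
  then show "partial_sum r i < partial_sum r j" using partial_sum_diff[of "i + 1" j r] ij by simp
qed (use n_pos in auto)

text \<open>
  For the chord condition at \<open>i < c < j\<close>, test the stability of the interval module on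
  \<open>{i + 1..j}\<close> with the part of it on the head side of the arrow between \<open>c\<close> and \<open>c + 1\<close>.
\<close>

lemma total_stability_iff_convex_position:
  assumes r: "r \<in> pos_orthant (verts Q)"
  shows "total_stability_condition Q (central_charge Q w r)
    \<longleftrightarrow> heights.convex_position n (partial_sum r) fwd (partial_sum w)"
proof -
  interpret heights n "partial_sum r" fwd by (rule heights_partial_sum[OF r])
  have rpos: "0 < r v" if "v \<in> verts Q" for v using r that by (auto simp: pos_orthant_def)
  have chord: "chord (partial_sum w) (a - 1) b = (\<Sum>i=a..b. w (\<sigma> i)) / (\<Sum>i=a..b. r (\<sigma> i))"
    if "1 \<le> a" "a \<le> b" for a b
    using partial_sum_diff that by (simp add: chord_def)
  show ?thesis
  proof
    assume tot: "total_stability_condition Q (central_charge Q w r)"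
    show "convex_position (partial_sum w)"
      unfolding convex_position_def
    proof (intro allI impI, elim conjE)
      fix i c j assume icj: "i < c" "c < j" "j \<le> n"
      obtain M y where M: "interval_rep M (i + 1) j y" using interval_rep_exists[of "i + 1" j] icj by auto
      have st: "stable Q (central_charge Q w r) M"
        using tot interval_rep_indecomposable[OF M] unfolding total_stability_condition_def by blast
      define S where "S = (if fwd c then {c + 1..j} else {i + 1..c})"
      have "S \<subset> {i + 1..j}" "S \<noteq> {}" using icj by (auto simp: S_def)
      moreover have "successor_closed fwd (i + 1) j S"
        unfolding successor_closed_def
      proof (intro ballI impI)
        fix l assume "l \<in> {i + 1..<j}" "src l \<in> S"
        then show "tgt l \<in> S"
          by (cases "l = c") (auto simp: S_def arrow_ends split: if_splits)
      qed
      ultimately have lt: "(\<Sum>l\<in>S. w (\<sigma> l)) / (\<Sum>l\<in>S. r (\<sigma> l)) < chord (partial_sum w) i j"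
        using st chord[of "i + 1" j] icj unfolding stable_interval_iff[OF M] by auto
      show "0 < bend (partial_sum w) i c j"
      proof (cases "fwd c")
        case True
        then have "chord (partial_sum w) c j < chord (partial_sum w) i j"
          using lt chord[of "c + 1" j] icj by (simp add: S_def)
        then show ?thesis using chord_mediant(4)[OF icj, of "partial_sum w"] True by (simp add: bend_def arrow_sign_def)
      next
        case False
        then have "chord (partial_sum w) i c < chord (partial_sum w) i j"
          using lt chord[of "i + 1" c] icj by (simp add: S_def)
        then show ?thesis using chord_mediant(1)[OF icj, of "partial_sum w"] False by (simp add: bend_def arrow_sign_def)
      qed
    qed
  next
    assume cp: "convex_position (partial_sum w)"
    have "stable Q (central_charge Q w r) M" if ind: "indecomposable Q M" for M
    proof -
      obtain a b y where M: "interval_rep M a b y" using indecomposable_imp_interval_rep[OF ind] by blast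
      have ab: "1 \<le> a" "a \<le> b" "b \<le> n" using interval_repD[OF M] by auto
      show ?thesis
        unfolding stable_interval_iff[OF M]
      proof (intro allI impI, elim conjE)
        fix S assume S: "S \<subset> {a..b}" "S \<noteq> {}" "successor_closed fwd a b S"
        have "(\<Sum>i\<in>S. partial_sum g i - partial_sum g (i - 1)) = (\<Sum>i\<in>S. g (\<sigma> i))" for g
          using S(1) ab by (intro sum.cong partial_sum_step) auto
        then show "(\<Sum>i\<in>S. w (\<sigma> i)) / (\<Sum>i\<in>S. r (\<sigma> i))
            < (\<Sum>i=a..b. w (\<sigma> i)) / (\<Sum>i=a..b. r (\<sigma> i))"
          using closed_subset_slope[OF cp ab S] chord[OF ab(1,2)] by simp
      qed
    qed
    then show "total_stability_condition Q (central_charge Q w r)"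
      unfolding total_stability_condition_def
      using central_charge_stability_condition[of r w] rpos by blast
  qed
qed

lemma partial_sum_surj:
  assumes "W 0 = 0"
  shows "\<exists>w\<in>coord_space (verts Q). \<forall>k\<le>n. partial_sum w k = W k"
proof -
  define w where "w v = (if v \<in> verts Q then W (idx v) - W (idx v - 1) else 0)" for v
  have "partial_sum w k = W k" if "k \<le> n" for k
    using that
  proof (induction k)
    case (Suc k)
    have "w (\<sigma> (Suc k)) = W (Suc k) - W k" using Suc.prems by (simp add: w_def)
    then show ?case using partial_sum_step[of "Suc k" w] Suc by simp
  qed (simp add: assms)
  moreover have "w \<in> coord_space (verts Q)" by (simp add: w_def coord_space_def)
  ultimately show ?thesis by blast
qed

lemma partial_sum_inj:
  assumes "x \<in> coord_space (verts Q)" "y \<in> coord_space (verts Q)"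
    and "\<And>k. k \<le> n \<Longrightarrow> partial_sum x k = partial_sum y k"
  shows "x = y"
proof
  fix v
  show "x v = y v"
  proof (cases "v \<in> verts Q")
    case True
    then obtain i where i: "i \<in> {1..n}" "v = \<sigma> i" by (auto simp: verts_eq)
    then show ?thesis using partial_sum_step[of i x] partial_sum_step[of i y] assms(3)[of i] assms(3)[of "i - 1"] by auto
  qed (use assms in \<open>auto simp: coord_space_def\<close>)
qed

text \<open>
  The coordinates of \<open>w\<close> are the height of the last point, which is unconstrained, and the local bend at
  each arrow, whose positivity is the defining condition of the fiber.
\<close>

lemma fiber_linear_iso:
  assumes r: "r \<in> pos_orthant (verts Q)"
  shows "\<exists>L. linear_iso (verts Q) (arcs Q) L
    \<and> L ` {w. (w, r) \<in> TS Q} = UNIV \<times> pos_orthant (arcs Q)"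
proof -
  interpret heights n "partial_sum r" fwd by (rule heights_partial_sum[OF r])
  define num where "num = inv_into {1..<n} \<tau>"
  have num: "num (\<tau> c) = c" if "c \<in> {1..<n}" for c
    unfolding num_def using bij_\<tau> that by (simp add: bij_betw_def)
  have num_in: "num a \<in> {1..<n}" "\<tau> (num a) = a" if "a \<in> arcs Q" for a
    using that num by (auto simp: arcs_eq)
  define L where "L w = (partial_sum w n, \<lambda>a. if a \<in> arcs Q then local_bend (partial_sum w) (num a) else 0)" for w
  have local_bend_cong: "local_bend W c = local_bend W' c"
    if "c \<in> {1..<n}" "\<And>k. k \<le> n \<Longrightarrow> W k = W' k" for W W' c
    using that neighbours(2,4,5)[OF that(1)] by (simp add: local_bend_def bend_def chord_def)
  have partial_sum_lin: "partial_sum (\<lambda>v. x v + y v) = (\<lambda>k. partial_sum x k + partial_sum y k)"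
    "partial_sum (\<lambda>v. c * x v) = (\<lambda>k. c * partial_sum x k)" for x y c
    by (auto simp: partial_sum_def sum.distrib sum_distrib_left)
  have surj: "\<exists>w\<in>coord_space (verts Q). L w = (t, d)" if d: "d \<in> coord_space (arcs Q)" for t d
  proof -
    obtain W where W: "W 0 = 0" "W n = t" "\<forall>c\<in>{1..<n}. local_bend W c = d (\<tau> c)"
      using local_bend_surj[of t "\<lambda>c. d (\<tau> c)"] by blast
    obtain w where w: "w \<in> coord_space (verts Q)" "\<forall>k\<le>n. partial_sum w k = W k"
      using partial_sum_surj[of W] W(1) by blast
    have "local_bend (partial_sum w) (num a) = d a" if "a \<in> arcs Q" for a
      using local_bend_cong[of "num a" "partial_sum w" W] W(3) w(2) num_in[OF that] by simp
    moreover have "d a = 0" if "a \<notin> arcs Q" for a using d that by (auto simp: coord_space_def)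
    ultimately have "L w = (t, d)" using W(2) w(2) by (auto simp: L_def)
    then show ?thesis using w(1) by blast
  qed
  have inj: "inj_on L (coord_space (verts Q))"
  proof (rule inj_onI)
    fix x y assume xy: "x \<in> coord_space (verts Q)" "y \<in> coord_space (verts Q)" and eq: "L x = L y"
    define D where "D k = partial_sum x k + (-1) * partial_sum y k" for k
    have "local_bend D c = 0" if c: "c \<in> {1..<n}" for c
    proof -
      have "local_bend (partial_sum x) c = local_bend (partial_sum y) c"
        using fun_cong[OF arg_cong[OF eq, of snd], of "\<tau> c"] c num[OF c] by (simp add: L_def)
      then show ?thesis unfolding D_def local_bend_add local_bend_scale by simp
    qed
    moreover have "D 0 = 0" "D n = 0" using eq by (auto simp: D_def L_def)
    ultimately have "D k = 0" if "k \<le> n" for k using local_bend_kernel[of D k] that by blast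
    then show "x = y" using partial_sum_inj[OF xy] by (simp add: D_def)
  qed
  have range: "L w \<in> UNIV \<times> coord_space (arcs Q)" for w by (simp add: L_def coord_space_def)
  have "L ` coord_space (verts Q) = UNIV \<times> coord_space (arcs Q)"
  proof
    show "UNIV \<times> coord_space (arcs Q) \<subseteq> L ` coord_space (verts Q)"
    proof
      fix p assume "p \<in> (UNIV :: real set) \<times> (coord_space (arcs Q) :: ('e \<Rightarrow> real) set)"
      then have "\<exists>w\<in>coord_space (verts Q). L w = (fst p, snd p)" by (intro surj) auto
      then show "p \<in> L ` coord_space (verts Q)" by (auto simp: image_iff)
    qed
  qed (use range in blast)
  then have "linear_iso (verts Q) (arcs Q) L"
    unfolding linear_iso_def bij_betw_def using inj
    by (auto simp: L_def partial_sum_lin local_bend_add local_bend_scale)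
  moreover have TS_iff: "(w, r) \<in> TS Q
      \<longleftrightarrow> w \<in> coord_space (verts Q) \<and> L w \<in> UNIV \<times> pos_orthant (arcs Q)" for w
  proof -
    have "(\<forall>c\<in>{1..<n}. 0 < local_bend (partial_sum w) c) \<longleftrightarrow> L w \<in> UNIV \<times> pos_orthant (arcs Q)"
      using num by (auto simp: L_def pos_orthant_def coord_space_def arcs_eq)
    then show ?thesis
      using r total_stability_iff_convex_position[OF r, of w] convex_position_iff_local_bend[of "partial_sum w"]
      by (auto simp: TS_def)
  qed
  moreover have "L ` {w. (w, r) \<in> TS Q} = UNIV \<times> pos_orthant (arcs Q)"
  proof (intro equalityI subsetI)
    fix p assume "p \<in> L ` {w. (w, r) \<in> TS Q}"
    then show "p \<in> UNIV \<times> pos_orthant (arcs Q)" using TS_iff by auto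
  next
    fix p assume p: "p \<in> (UNIV :: real set) \<times> pos_orthant (arcs Q)"
    then have "snd p \<in> coord_space (arcs Q)" by (auto simp: pos_orthant_def)
    then obtain w where w: "w \<in> coord_space (verts Q)" "L w = (fst p, snd p)"
      using surj[of "snd p" "fst p"] by auto
    then have "(w, r) \<in> TS Q" using TS_iff p by simp
    then show "p \<in> L ` {w. (w, r) \<in> TS Q}" using w(2) by (intro image_eqI[of _ _ w]) auto
  qed
  ultimately show ?thesis by (intro exI[of _ L] conjI)
qed

end

theorem corollary1p17:
  fixes scale :: "'k::alg_closed_field \<Rightarrow> 'b::ab_group_add \<Rightarrow> 'b"
    and Q :: "('v, 'e) pre_digraph"
  assumes "rep_universe scale"
    and "type_A Q"
  shows "snd ` rep_universe.TS scale Q = pos_orthant (verts Q)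
    \<and> (\<forall>r\<in>pos_orthant (verts Q). \<exists>L. linear_iso (verts Q) (arcs Q) L
        \<and> L ` {w. (w, r) \<in> rep_universe.TS scale Q} = UNIV \<times> pos_orthant (arcs Q))
    \<and> (\<forall>r\<in>pos_orthant (verts Q). \<exists>w\<in>coord_space (verts Q).
        rep_universe.total_stability_condition scale Q (central_charge Q w r))"
proof -
  obtain n \<sigma> \<tau> where numbering: "1 \<le> n" "bij_betw \<sigma> {1..n::nat} (verts Q)"
    "bij_betw \<tau> {1..<n} (arcs Q)"
    "\<forall>i\<in>{1..<n}. {tail Q (\<tau> i), head Q (\<tau> i)} = {\<sigma> i, \<sigma> (i + 1)}"
    using assms(2) unfolding type_A_def by blast
  interpret rep_universe scale by fact
  interpret type_A_reps scale Q n \<sigma> \<tau>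
    by unfold_locales (use numbering in auto)
  have ex: "\<exists>w. (w, r) \<in> TS Q" if r: "r \<in> pos_orthant (verts Q)" for r
  proof -
    obtain L where "L ` {w. (w, r) \<in> TS Q} = (UNIV :: real set) \<times> pos_orthant (arcs Q)"
      using fiber_linear_iso[OF r] by blast
    moreover have "(0, \<lambda>a. if a \<in> arcs Q then 1 else 0) \<in> (UNIV :: real set) \<times> pos_orthant (arcs Q)"
      by (simp add: pos_orthant_def coord_space_def)
    ultimately show ?thesis by blast
  qed
  have "snd ` TS Q = pos_orthant (verts Q)"
  proof
    show "snd ` TS Q \<subseteq> pos_orthant (verts Q)" by (auto simp: TS_def)
    show "pos_orthant (verts Q) \<subseteq> snd ` TS Q" using ex by force
  qed
  moreover have "\<exists>w\<in>coord_space (verts Q). total_stability_condition Q (central_charge Q w r)"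
    if "r \<in> pos_orthant (verts Q)" for r
    using ex[OF that] by (auto simp: TS_def)
  ultimately show ?thesis by (intro conjI ballI fiber_linear_iso)
qed

end
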